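(* Let $\theta\in(0,1/2)$ be irrational, let $V$ be the unitary on $L^2(\mathbb{R}/\mathbb{Z})$ (with Lebesgue measure) given by $(V\xi)(x)=\xi(x-\theta)$, let $n$ be an integer greater than $1$, and let $C=[0,\theta)\subset\mathbb{R}/\mathbb{Z}$, $D=(\mathbb{R}/\mathbb{Z})\setminus C$. For $\lambda=(\lambda_1,\lambda_2)$ with $\lambda_1,\lambda_2\in\mathbb{C}$, $|\lambda_1|=|\lambda_2|=1$, let $W(\lambda)=\chi_C\otimes\lambda_1u^*+\chi_D\otimes\lambda_2v^*\in L^\infty(\mathbb{R}/\mathbb{Z})\otimes M_n$. The following conditions are equivalent for two such pairs $\lambda=(\lambda_1,\lambda_2)$, $\lambda'=(\lambda_1',\lambda_2')$: (1) $W(\lambda)V$ and $W(\lambda')V$ are unitarily equivalent, i.e., there is a unitary $\zeta\in L^\infty(\mathbb{R}/\mathbb{Z})\otimes M_n$ such that $W(\lambda)=\zeta W(\lambda')\bar\alpha(\zeta)^*$, where $\bar\alpha=\mathrm{Ad}\,V$. (2) $\lambda_1^n=e^{2\pi ia(\theta-1)}(\lambda_1')^n$ and $\lambda_2^n=e^{2\pi ia\theta}(\lambda_2')^n$ for some $a\in\mathbb{R}$.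
   Context: $V$ also denotes $V\otimes1$ on $L^2(\mathbb{R}/\mathbb{Z})\otimes\mathbb{C}^n$, and $\mathrm{Ad}\,V(T)=VTV^*$. $M_n$ is the algebra of complex $n\times n$ matrices, $\omega=e^{2\pi i/n}$, $u=\mathrm{diag}(1,\omega,\dots,\omega^{n-1})$, and $v\in M_n$ is the cyclic shift permutation unitary with $vuv^*=\omega u$. $\chi_S$ is the characteristic function of $S$. *)

theory Defs
  imports
    "HOL-Analysis.Lebesgue_Measure"
    "HOL-Analysis.Bochner_Integration"
    "Jordan_Normal_Form.Schur_Decomposition"
begin

subsection \<open>The circle group \<open>\<real>/\<int>\<close> and its Lebesgue measure\<close>

definition int_cong :: "real \<Rightarrow> real \<Rightarrow> bool" where
  "int_cong x y \<longleftrightarrow> x - y \<in> \<int>"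

lemma equivp_int_cong: "equivp int_cong"
proof (rule equivpI)
  show "reflp int_cong"
    by (simp add: reflp_def int_cong_def)
  show "symp int_cong"
    unfolding symp_def int_cong_def by (metis Ints_minus minus_diff_eq)
  show "transp int_cong"
    unfolding transp_def int_cong_def by (metis Ints_add diff_add_cancel add_diff_eq)
qed

quotient_type circle = real / int_cong
  morphisms rep_circle to_circle
  by (rule equivp_int_cong)

instantiation circle :: ab_group_add
begin

lift_definition zero_circle :: circle is 0 .

lift_definition plus_circle :: "circle \<Rightarrow> circle \<Rightarrow> circle" is "(+)"
  unfolding int_cong_def by (metis Ints_add add_diff_add)

lift_definition uminus_circle :: "circle \<Rightarrow> circle" is uminus
  unfolding int_cong_def by (metis Ints_minus minus_diff_minus)

lift_definition minus_circle :: "circle \<Rightarrow> circle \<Rightarrow> circle" is "(-)"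
proof -
  fix a b c d :: real
  assume "int_cong a b" "int_cong c d"
  then have "(a - b) - (c - d) \<in> \<int>"
    unfolding int_cong_def by (rule Ints_diff)
  then show "int_cong (a - c) (b - d)"
    unfolding int_cong_def by (simp add: algebra_simps)
qed

instance
  by standard (transfer; simp add: int_cong_def algebra_simps)+

end

text \<open>
  A subset of \<open>\<real>/\<int>\<close> is Borel iff its preimage in \<open>\<real>\<close> is, and its measure
  is that of its preimage in the fundamental domain \<open>[0, 1)\<close>.
\<close>

definition circle_lebesgue :: "circle measure" where
  "circle_lebesgue =
     distr (restrict_space lborel {0..<1})
       (sigma UNIV {A. to_circle -` A \<in> sets borel}) to_circle"


subsection \<open>The Hilbert space \<open>L\<^sup>2(\<real>/\<int>) \<otimes> \<complex>\<^sup>n\<close>\<close>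

text \<open>
  \<open>L\<^sup>2(\<real>/\<int>) \<otimes> \<complex>\<^sup>n\<close> is identified with \<open>L\<^sup>2(\<real>/\<int>; \<complex>\<^sup>n)\<close>, whose elements are
  classes of square-integrable functions modulo equality almost everywhere.
\<close>

definition L2_fun :: "nat \<Rightarrow> (circle \<Rightarrow> complex vec) set" where
  "L2_fun n = {\<xi>. (\<forall>x. \<xi> x \<in> carrier_vec n) \<and>
     (\<forall>i<n. (\<lambda>x. vec_index (\<xi> x) i) \<in> borel_measurable circle_lebesgue \<and>
            integrable circle_lebesgue (\<lambda>x. (cmod (vec_index (\<xi> x) i))\<^sup>2))}"

definition ae_eq :: "nat \<Rightarrow> ((circle \<Rightarrow> complex vec) \<times> (circle \<Rightarrow> complex vec)) set" where
  "ae_eq n = {(\<xi>, \<eta>). \<xi> \<in> L2_fun n \<and> \<eta> \<in> L2_fun n \<and> (AE x in circle_lebesgue. \<xi> x = \<eta> x)}"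

definition L2 :: "nat \<Rightarrow> (circle \<Rightarrow> complex vec) set set" where
  "L2 n = L2_fun n // ae_eq n"

text \<open>The inner product, evaluated on arbitrary representatives of the two classes.\<close>

definition L2_inner :: "(circle \<Rightarrow> complex vec) set \<Rightarrow> (circle \<Rightarrow> complex vec) set \<Rightarrow> complex" where
  "L2_inner X Y = (\<integral>x. (SOME \<xi>. \<xi> \<in> X) x \<bullet>c (SOME \<eta>. \<eta> \<in> Y) x \<partial>circle_lebesgue)"


subsection \<open>Operators\<close>

text \<open>
  Operators on \<open>L2 n\<close> are extensional functions \<open>L2 n \<rightarrow>\<^sub>E L2 n\<close>, so that equality of
  operators is equality in the logic.
\<close>

type_synonym L2_op = "(circle \<Rightarrow> complex vec) set \<Rightarrow> (circle \<Rightarrow> complex vec) set"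

text \<open>The operator induced by a map on functions that preserves \<open>L2_fun n\<close> and \<open>ae_eq n\<close>.\<close>

definition induced_op ::
  "nat \<Rightarrow> ((circle \<Rightarrow> complex vec) \<Rightarrow> (circle \<Rightarrow> complex vec)) \<Rightarrow> L2_op" where
  "induced_op n T = (\<lambda>X\<in>L2 n. \<Union>\<xi>\<in>X. ae_eq n `` {T \<xi>})"

definition op_id :: "nat \<Rightarrow> L2_op" where
  "op_id n = (\<lambda>X\<in>L2 n. X)"

definition op_mult :: "nat \<Rightarrow> L2_op \<Rightarrow> L2_op \<Rightarrow> L2_op" where
  "op_mult n S T = compose (L2 n) S T"

definition op_adjoint :: "nat \<Rightarrow> L2_op \<Rightarrow> L2_op" where
  "op_adjoint n T =
     (THE S. S \<in> L2 n \<rightarrow>\<^sub>E L2 n \<and> (\<forall>X\<in>L2 n. \<forall>Y\<in>L2 n. L2_inner (T X) Y = L2_inner X (S Y)))"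

definition op_unitary :: "nat \<Rightarrow> L2_op \<Rightarrow> bool" where
  "op_unitary n T \<longleftrightarrow> T \<in> L2 n \<rightarrow>\<^sub>E L2 n \<and>
     op_mult n (op_adjoint n T) T = op_id n \<and> op_mult n T (op_adjoint n T) = op_id n"

definition Ad :: "nat \<Rightarrow> L2_op \<Rightarrow> L2_op \<Rightarrow> L2_op" where
  "Ad n U T = op_mult n (op_mult n U T) (op_adjoint n U)"

text \<open>\<open>V \<otimes> 1\<close>, where \<open>(V \<xi>)(x) = \<xi>(x - \<theta>)\<close>.\<close>

definition V_op :: "nat \<Rightarrow> real \<Rightarrow> L2_op" where
  "V_op n \<theta> = induced_op n (\<lambda>\<xi> x. \<xi> (x - to_circle \<theta>))"


subsection \<open>The algebra \<open>L\<^sup>\<infinity>(\<real>/\<int>) \<otimes> M\<^sub>n\<close>\<close>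

text \<open>
  \<open>L\<^sup>\<infinity>(\<real>/\<int>) \<otimes> M\<^sub>n\<close> is identified with \<open>L\<^sup>\<infinity>(\<real>/\<int>; M\<^sub>n)\<close>, acting on \<open>L2 n\<close> by pointwise
  multiplication; \<open>f \<otimes> m\<close> corresponds to \<open>x \<mapsto> f(x) m\<close>.
\<close>

definition Linf_fun :: "nat \<Rightarrow> (circle \<Rightarrow> complex mat) set" where
  "Linf_fun n = {F. (\<forall>x. F x \<in> carrier_mat n n) \<and>
     (\<forall>i<n. \<forall>j<n. (\<lambda>x. index_mat (F x) (i, j)) \<in> borel_measurable circle_lebesgue \<and>
        (\<exists>B. AE x in circle_lebesgue. cmod (index_mat (F x) (i, j)) \<le> B))}"

definition mult_op :: "nat \<Rightarrow> (circle \<Rightarrow> complex mat) \<Rightarrow> L2_op" where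
  "mult_op n F = induced_op n (\<lambda>\<xi> x. F x *\<^sub>v \<xi> x)"

definition Linf_Mn :: "nat \<Rightarrow> L2_op set" where
  "Linf_Mn n = mult_op n ` Linf_fun n"

definition tensor :: "(circle \<Rightarrow> complex) \<Rightarrow> complex mat \<Rightarrow> circle \<Rightarrow> complex mat" where
  "tensor f m = (\<lambda>x. f x \<cdot>\<^sub>m m)"


subsection \<open>The operators \<open>W(\<lambda>)\<close>\<close>

definition omega :: "nat \<Rightarrow> complex" where
  "omega n = exp (2 * of_real pi * \<i> / of_nat n)"

definition u_mat :: "nat \<Rightarrow> complex mat" where
  "u_mat n = mat n n (\<lambda>(i, j). if i = j then omega n ^ i else 0)"

text \<open>
  The shift \<open>e\<^sub>j \<mapsto> e\<^sub>j\<^sub>-\<^sub>1\<close> (indices modulo \<open>n\<close>); the direction is the one for which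
  \<open>v u v\<^sup>* = \<omega> u\<close>, see \<open>v_u_adjoint_v\<close> below.
\<close>

definition v_mat :: "nat \<Rightarrow> complex mat" where
  "v_mat n = mat n n (\<lambda>(i, j). if j = Suc i mod n then 1 else 0)"

definition arc_C :: "real \<Rightarrow> circle set" where
  "arc_C \<theta> = to_circle ` {0..<\<theta>}"

definition arc_D :: "real \<Rightarrow> circle set" where
  "arc_D \<theta> = - arc_C \<theta>"

definition W_op :: "nat \<Rightarrow> real \<Rightarrow> complex \<times> complex \<Rightarrow> L2_op" where
  "W_op n \<theta> l = mult_op n (\<lambda>x.
     tensor (indicator (arc_C \<theta>)) (fst l \<cdot>\<^sub>m mat_adjoint (u_mat n)) x +
     tensor (indicator (arc_D \<theta>)) (snd l \<cdot>\<^sub>m mat_adjoint (v_mat n)) x)"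

lemma mat_adjoint_index:
  assumes "A \<in> carrier_mat n n" "i < n" "j < n"
  shows "index_mat (mat_adjoint A) (i, j) = conjugate (index_mat A (j, i))"
  using assms by (simp add: mat_adjoint_def mat_of_rows_def)

lemma mat_adjoint_carrier:
  assumes "A \<in> carrier_mat n n"
  shows "mat_adjoint A \<in> carrier_mat n n"
  using carrier_matD[OF assms] by (intro carrier_matI) (simp_all add: mat_adjoint_def)

lemma mat_mult_index:
  assumes "A \<in> carrier_mat n n" "B \<in> carrier_mat n n" "i < n" "j < n"
  shows "index_mat (A * B) (i, j) = (\<Sum>k\<in>{0..<n}. index_mat A (i, k) * index_mat B (k, j))"
  using assms by (simp add: scalar_prod_def)

lemma omega_pow:
  assumes "n > 0"
  shows "omega n ^ n = 1"
proof -
  have "omega n ^ n = exp (of_nat n * (2 * of_real pi * \<i> / of_nat n))"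
    unfolding omega_def by (rule exp_of_nat_mult[symmetric])
  also have "of_nat n * (2 * of_real pi * \<i> / of_nat n) = 2 * of_real pi * \<i>"
    using assms by simp
  finally show ?thesis
    by (simp only: exp_two_pi_i)
qed

lemma v_u_adjoint_v:
  assumes "n > 0"
  shows "v_mat n * u_mat n * mat_adjoint (v_mat n) = omega n \<cdot>\<^sub>m u_mat n"
proof (rule eq_matI)
  have c: "v_mat n \<in> carrier_mat n n" "u_mat n \<in> carrier_mat n n"
    by (auto simp: v_mat_def u_mat_def)
  note ca = mat_adjoint_carrier[OF c(1)]
  show "dim_row (v_mat n * u_mat n * mat_adjoint (v_mat n)) = dim_row (omega n \<cdot>\<^sub>m u_mat n)"
       "dim_col (v_mat n * u_mat n * mat_adjoint (v_mat n)) = dim_col (omega n \<cdot>\<^sub>m u_mat n)"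
    using c ca by auto
  fix i j
  assume "i < dim_row (omega n \<cdot>\<^sub>m u_mat n)" "j < dim_col (omega n \<cdot>\<^sub>m u_mat n)"
  then have ij: "i < n" "j < n"
    using c by auto
  have vu: "index_mat (v_mat n * u_mat n) (i, k) =
      (if k = Suc i mod n then omega n ^ k else 0)" if "k < n" for k
  proof -
    have "index_mat (v_mat n * u_mat n) (i, k) =
        (\<Sum>l\<in>{0..<n}. (if l = Suc i mod n then 1 else 0) * (if l = k then omega n ^ l else 0))"
      using ij that by (simp add: v_mat_def u_mat_def scalar_prod_def)
    also have "\<dots> = (\<Sum>l\<in>{0..<n}. if l = k then
        (if k = Suc i mod n then omega n ^ k else 0) else 0)"
      by (intro sum.cong) auto
    finally show ?thesis
      using that by simp
  qed
  have pow: "omega n ^ (Suc i mod n) = omega n ^ Suc i"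
    using omega_pow[OF assms] ij
    by (cases "Suc i = n") auto
  have inj: "Suc j mod n = Suc i mod n \<longleftrightarrow> i = j"
  proof (cases "Suc i = n"; cases "Suc j = n")
    assume "Suc i \<noteq> n" "Suc j \<noteq> n"
    then have "Suc i mod n = Suc i" "Suc j mod n = Suc j"
      using ij by simp_all
    then show ?thesis by auto
  qed (use ij in auto)
  have entry: "index_mat (v_mat n * u_mat n) (i, k) * index_mat (mat_adjoint (v_mat n)) (k, j) =
      (if k = Suc i mod n then (if i = j then omega n ^ Suc i else 0) else 0)"
    if k: "k < n" for k
  proof -
    have "index_mat (mat_adjoint (v_mat n)) (k, j) = (if k = Suc j mod n then 1 else 0)"
      using k ij by (simp add: mat_adjoint_index[OF c(1)]) (simp add: v_mat_def)
    then show ?thesis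
      unfolding vu[OF k] using pow inj by (metis mult.right_neutral mult_zero_left mult_zero_right)
  qed
  have "index_mat (v_mat n * u_mat n * mat_adjoint (v_mat n)) (i, j) =
      (\<Sum>k\<in>{0..<n}. index_mat (v_mat n * u_mat n) (i, k) *
         index_mat (mat_adjoint (v_mat n)) (k, j))"
    using ij c ca by (intro mat_mult_index mult_carrier_mat)
  also have "\<dots> = (\<Sum>k\<in>{0..<n}. if k = Suc i mod n then
      (if i = j then omega n ^ Suc i else 0) else 0)"
    by (intro sum.cong refl entry) simp
  also have "\<dots> = index_mat (omega n \<cdot>\<^sub>m u_mat n) (i, j)"
    using ij by (simp add: u_mat_def)
  finally show "index_mat (v_mat n * u_mat n * mat_adjoint (v_mat n)) (i, j) =
      index_mat (omega n \<cdot>\<^sub>m u_mat n) (i, j)" .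
qed

end

theory Submission
  imports Defs "HOL-Analysis.Analysis" "HOL-Number_Theory.Cong"
begin

text \<open>
  On functions the equation \<open>W(\<lambda>) = \<zeta> W(\<lambda>') \<alpha>(\<zeta>)\<^sup>*\<close> reads \<open>W(\<lambda>)(x) \<zeta>(x - \<theta>) = \<zeta>(x) W(\<lambda>')(x)\<close> almost
  everywhere. Taking determinants, \<open>f = det \<zeta>\<close> satisfies \<open>f(x) = c(x) f(x - \<theta>)\<close> with \<open>c\<close> constant on
  \<open>C\<close> and on \<open>D\<close>. As the two jumps of \<open>c\<close> lie on one orbit of the rotation, multiplying \<open>f\<close> by
  \<open>exp (-2\<pi>ibx)\<close>, \<open>0 \<le> x < 1\<close>, for a suitable real \<open>b\<close> makes the factor constant; a constant factor is an
  eigenvalue of the rotation, hence \<open>exp (2\<pi>ik\<theta>)\<close> for an integer \<open>k\<close>, and \<open>a = b + k\<close> works.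

  Conversely, the scalar factor \<open>exp (2\<pi>iax/n)\<close>, \<open>0 \<le> x < 1\<close>, reduces to the case that \<open>\<lambda>\<^sub>1/\<lambda>'\<^sub>1\<close> and \<open>\<lambda>\<^sub>2/\<lambda>'\<^sub>2\<close> are \<open>n\<close>-th roots
  of unity, and these are produced by conjugating with \<open>u\<^sup>p v\<^sup>q\<close>.
\<close>

subsection \<open>Lebesgue measure on the circle\<close>

text \<open>The sets with Borel preimage already form a sigma-algebra, so generating one from them
  adds nothing.\<close>

lemma sets_circle_lebesgue: "sets circle_lebesgue = {A. to_circle -` A \<in> sets borel}"
proof -
  have "sigma_algebra UNIV {A. to_circle -` A \<in> sets borel}"
    by (auto simp: sigma_algebra_iff2 vimage_Diff vimage_UN)
  from sigma_algebra.sigma_sets_eq[OF this] show ?thesis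
    by (simp add: circle_lebesgue_def)
qed

lemma space_circle_lebesgue [simp]: "space circle_lebesgue = UNIV"
  by (simp add: circle_lebesgue_def space_measure_of_conv)

lemma measurable_to_circle [measurable]: "to_circle \<in> borel \<rightarrow>\<^sub>M circle_lebesgue"
  by (rule measurableI) (simp_all add: sets_circle_lebesgue)

lemma circle_cases: obtains r where "x = to_circle r"
  by (induction x rule: circle.abs_induct) blast

text \<open>The sigma-algebra on the circle is the final one for the surjection
  \<open>to_circle\<close>. Measurability questions on the circle thus become questions about
  periodic functions on the line.\<close>

lemma measurable_circle_iff:
  "f \<in> circle_lebesgue \<rightarrow>\<^sub>M N \<longleftrightarrow> (\<lambda>x. f (to_circle x)) \<in> borel \<rightarrow>\<^sub>M N"
proof
  assume f: "(\<lambda>x. f (to_circle x)) \<in> borel \<rightarrow>\<^sub>M N"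
  show "f \<in> circle_lebesgue \<rightarrow>\<^sub>M N"
  proof (rule measurableI)
    fix x show "f x \<in> space N"
      using measurable_space[OF f] by (cases x rule: circle_cases) auto
  next
    fix B assume "B \<in> sets N"
    then show "f -` B \<inter> space circle_lebesgue \<in> sets circle_lebesgue"
      using measurable_sets[OF f] by (simp add: sets_circle_lebesgue vimage_def)
  qed
qed simp

lemma to_circle_eq_iff: "to_circle x = to_circle y \<longleftrightarrow> x - y \<in> \<int>"
  by (simp add: circle.abs_eq_iff int_cong_def)

lemma to_circle_add: "to_circle (x + y) = to_circle x + to_circle y"
  by (simp add: plus_circle.abs_eq)

lemma to_circle_diff: "to_circle (x - y) = to_circle x - to_circle y"
  by (simp add: minus_circle.abs_eq)

lemma to_circle_frac: "to_circle (frac x) = to_circle x"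
  by (simp add: to_circle_eq_iff frac_def)

lemma measurable_circle_add [measurable]:
  "(\<lambda>x. x + c) \<in> circle_lebesgue \<rightarrow>\<^sub>M circle_lebesgue"
  by (cases c rule: circle_cases) (simp add: measurable_circle_iff to_circle_add[symmetric])

lemma measurable_circle_diff [measurable]:
  "(\<lambda>x. x - c) \<in> circle_lebesgue \<rightarrow>\<^sub>M circle_lebesgue"
  using measurable_circle_add[of "- c"] by simp

lemma emeasure_circle_lebesgue:
  assumes "A \<in> sets circle_lebesgue"
  shows "emeasure circle_lebesgue A = emeasure lborel (to_circle -` A \<inter> {0..<1})"
proof -
  let ?S = "sigma UNIV {A. to_circle -` A \<in> sets borel}"
  have S: "sets ?S = sets circle_lebesgue"
    by (simp add: circle_lebesgue_def)
  have "to_circle \<in> restrict_space lborel {0..<1} \<rightarrow>\<^sub>M circle_lebesgue"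
    by (rule measurable_restrict_space1) simp
  then have "to_circle \<in> restrict_space lborel {0..<1} \<rightarrow>\<^sub>M ?S"
    using measurable_cong_sets[OF refl S] by blast
  from emeasure_distr[OF this, of A] assms S have "emeasure circle_lebesgue A =
      emeasure (restrict_space lborel {0..<1}) (to_circle -` A \<inter> space (restrict_space lborel {0..<1}))"
    by (metis circle_lebesgue_def)
  then show ?thesis
    by (simp add: space_restrict_space emeasure_restrict_space)
qed

lemma emeasure_circle_lebesgue_UNIV: "emeasure circle_lebesgue UNIV = 1"
  by (subst emeasure_circle_lebesgue) (simp_all add: sets_circle_lebesgue)

lemma finite_measure_circle_lebesgue: "finite_measure circle_lebesgue"
  by (rule finite_measureI) (simp add: emeasure_circle_lebesgue_UNIV)

interpretation circle_lebesgue: finite_measure circle_lebesgue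
  by (rule finite_measure_circle_lebesgue)

section \<open>Rotation invariance\<close>

lemma emeasure_lborel_shift:
  assumes "B \<in> sets borel"
  shows "emeasure lborel {x. x + t \<in> B} = emeasure lborel (B :: real set)"
proof -
  have "emeasure lborel B = emeasure (distr lborel borel ((+) t)) B"
    by (simp add: lborel_distr_plus)
  also have "\<dots> = emeasure lborel ((+) t -` B \<inter> space lborel)"
    using assms by (intro emeasure_distr) auto
  finally show ?thesis
    by (simp add: vimage_def add.commute)
qed

text \<open>Translation carries \<open>[0, 1)\<close> to \<open>[t, t + 1)\<close>. The piece beyond
  1 is moved back by one period onto \<open>[0, t)\<close>, which completes \<open>[t, 1)\<close> to
  the fundamental domain.\<close>

lemma emeasure_lborel_periodic_shift:
  fixes B :: "real set"
  assumes B [measurable]: "B \<in> sets borel" and per: "\<And>x. x + 1 \<in> B \<longleftrightarrow> x \<in> B"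
    and t: "0 \<le> t" "t < 1"
  shows "emeasure lborel ({x. x + t \<in> B} \<inter> {0..<1}) = emeasure lborel (B \<inter> {0..<1})"
proof -
  have "{x. x + t \<in> B} \<inter> {0..<1} = {x. x + t \<in> B \<inter> {t..<t+1}}"
    by auto
  then have "emeasure lborel ({x. x + t \<in> B} \<inter> {0..<1}) = emeasure lborel (B \<inter> {t..<t+1})"
    by (simp only: emeasure_lborel_shift sets.Int B atLeastLessThan_borel)
  also have "B \<inter> {t..<t+1} = (B \<inter> {t..<1}) \<union> (B \<inter> {1..<t+1})"
    using t by auto
  also have "emeasure lborel \<dots> = emeasure lborel (B \<inter> {t..<1}) + emeasure lborel (B \<inter> {1..<t+1})"
    by (rule plus_emeasure[symmetric]) auto
  also have "emeasure lborel (B \<inter> {1..<t+1}) = emeasure lborel {x. x + 1 \<in> B \<inter> {1..<t+1}}"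
    by (rule emeasure_lborel_shift[symmetric]) simp
  also have "{x. x + 1 \<in> B \<inter> {1..<t+1}} = B \<inter> {0..<t}"
    using per by auto
  also have "emeasure lborel (B \<inter> {t..<1}) + emeasure lborel (B \<inter> {0..<t}) =
      emeasure lborel ((B \<inter> {t..<1}) \<union> (B \<inter> {0..<t}))"
    by (rule plus_emeasure) auto
  also have "(B \<inter> {t..<1}) \<union> (B \<inter> {0..<t}) = B \<inter> {0..<1}"
    using t by auto
  finally show ?thesis .
qed

text \<open>Choosing the representative of \<open>c\<close> in \<open>[0, 1)\<close> reduces this to
  the shift of a periodic Borel set. Invariance of integrals, integrability and null sets follows
  from this one identity.\<close>

lemma distr_circle_add: "distr circle_lebesgue circle_lebesgue (\<lambda>x. x + c) = circle_lebesgue"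
proof (rule measure_eqI)
  fix A assume "A \<in> sets (distr circle_lebesgue circle_lebesgue (\<lambda>x. x + c))"
  then have A [measurable]: "A \<in> sets circle_lebesgue" by simp
  obtain r where r: "c = to_circle r" by (rule circle_cases)
  define t where "t = frac r"
  have c: "c = to_circle t" and t: "0 \<le> t" "t < 1"
    by (simp_all add: t_def r to_circle_frac frac_lt_1)
  have "to_circle (x + 1) = to_circle x" for x
    by (simp add: to_circle_eq_iff)
  then have "emeasure lborel ({x. x + t \<in> to_circle -` A} \<inter> {0..<1}) =
      emeasure lborel (to_circle -` A \<inter> {0..<1})"
    using A t by (intro emeasure_lborel_periodic_shift) (auto simp: sets_circle_lebesgue)
  moreover have "(\<lambda>x. x + c) -` A \<in> sets circle_lebesgue"
    using measurable_sets[OF measurable_circle_add A] by simp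
  moreover have "to_circle -` (\<lambda>x. x + c) -` A = {x. x + t \<in> to_circle -` A}"
    by (auto simp: c to_circle_add)
  ultimately show "emeasure (distr circle_lebesgue circle_lebesgue (\<lambda>x. x + c)) A =
      emeasure circle_lebesgue A"
    by (simp add: emeasure_distr emeasure_circle_lebesgue)
qed simp

lemma integral_circle_add:
  fixes f :: "circle \<Rightarrow> 'a :: {banach, second_countable_topology}"
  assumes "f \<in> borel_measurable circle_lebesgue"
  shows "(\<integral>x. f (x + c) \<partial>circle_lebesgue) = (\<integral>x. f x \<partial>circle_lebesgue)"
  using integral_distr[OF measurable_circle_add assms, of c] by (simp add: distr_circle_add)

lemma integrable_circle_add:
  fixes f :: "circle \<Rightarrow> 'a :: {banach, second_countable_topology}"
  assumes "integrable circle_lebesgue f"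
  shows "integrable circle_lebesgue (\<lambda>x. f (x + c))"
  using integrable_distr[OF measurable_circle_add, of c f] assms by (simp add: distr_circle_add)

lemma AE_circle_add:
  assumes "AE x in circle_lebesgue. P x"
  shows "AE x in circle_lebesgue. P (x + c)"
  by (rule AE_distrD[OF measurable_circle_add[of c]]) (unfold distr_circle_add, rule assms)

subsection \<open>Uniqueness of Fourier coefficients\<close>

text \<open>The generating character of the circle; its integer powers are the Fourier
  basis.\<close>

lift_definition circle_char :: "circle \<Rightarrow> complex" is "\<lambda>x. cis (2 * pi * x)"
proof -
  fix x y :: real
  assume "int_cong x y"
  then obtain k where "x = y + of_int k"
    unfolding int_cong_def by (metis Ints_cases add.commute diff_add_cancel)
  then show "cis (2 * pi * x) = cis (2 * pi * y)"
    by (simp add: distrib_left cis_mult[symmetric] cis_multiple_2pi mult.commute[of pi])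
qed

lemma circle_char_to_circle: "circle_char (to_circle x) = cis (2 * pi * x)"
  by (rule circle_char.abs_eq)

lemma norm_circle_char [simp]: "cmod (circle_char x) = 1"
  by transfer simp

lemma circle_char_nonzero [simp]: "circle_char x \<noteq> 0"
  using norm_circle_char[of x] by fastforce

lemma circle_char_add: "circle_char (x + y) = circle_char x * circle_char y"
  by transfer (simp add: cis_mult distrib_left)

lemma circle_char_diff: "circle_char (x - y) = circle_char x / circle_char y"
  using circle_char_add[of "x - y" y] by (simp add: field_simps)

lemma measurable_circle_char [measurable]: "circle_char \<in> borel_measurable circle_lebesgue"
  unfolding measurable_circle_iff circle_char_to_circle
  by (intro borel_measurable_continuous_onI continuous_intros)

text \<open>Provides a left inverse of \<open>circle_char\<close>: the values of
  \<open>Arg2pi\<close> lie in \<open>[0, 2 pi)\<close>, which matches the fundamental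
  domain.\<close>

lemma to_circle_Arg2pi_circle_char: "to_circle (Arg2pi (circle_char x) / (2 * pi)) = x"
proof -
  obtain r where "x = to_circle r" by (rule circle_cases)
  then have x: "x = to_circle (frac r)"
    by (simp add: to_circle_frac)
  have "Arg2pi (cis (2 * pi * frac r)) = 2 * pi * frac r"
    by (rule Arg2pi_unique[of 1]) (auto simp: cis_conv_exp frac_lt_1)
  then show ?thesis
    by (simp add: x circle_char_to_circle)
qed

text \<open>The left inverse of \<open>circle_char\<close> is measurable, so pulling
  \<open>A\<close> back along it gives a suitable \<open>B\<close>. This moves measurable sets to
  the complex plane, where open sets generate and polynomial approximation is available.\<close>

lemma sets_circle_eq_vimage:
  assumes "A \<in> sets circle_lebesgue"
  obtains B where "B \<in> sets borel" "A = circle_char -` B"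
proof
  \<comment> \<open>\<open>Arg2pi\<close> jumps across the nonnegative real axis, but its strict
    superlevel sets are open.\<close>
  have [measurable]: "Arg2pi \<in> borel_measurable borel"
    by (rule borel_measurableI_greater) (simp add: open_Arg2pi2pi_gt)
  have "(\<lambda>z. to_circle (Arg2pi z / (2 * pi))) \<in> borel \<rightarrow>\<^sub>M circle_lebesgue"
    by measurable
  from measurable_sets[OF this assms]
  show "(\<lambda>z. to_circle (Arg2pi z / (2 * pi))) -` A \<in> sets borel" by simp
  show "A = circle_char -` (\<lambda>z. to_circle (Arg2pi z / (2 * pi))) -` A"
    by (auto simp: to_circle_Arg2pi_circle_char)
qed

text \<open>All Fourier coefficients vanish; as \<open>k\<close> runs through all integers, the sign
  convention in the exponent is immaterial.\<close>

definition fourier_null :: "(circle \<Rightarrow> complex) \<Rightarrow> bool" where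
  "fourier_null g \<longleftrightarrow> integrable circle_lebesgue g \<and>
     (\<forall>k::int. (\<integral>x. g x * circle_char x powi k \<partial>circle_lebesgue) = 0)"

lemma measurable_circle_char_powi [measurable]:
  "(\<lambda>x. circle_char x powi k) \<in> borel_measurable circle_lebesgue"
  by (simp add: power_int_def)

lemma integrable_mult_bounded:
  fixes g h :: "'a \<Rightarrow> complex"
  assumes "integrable M g" "h \<in> borel_measurable M" "\<And>x. cmod (h x) \<le> B"
  shows "integrable M (\<lambda>x. g x * h x)"
proof (rule Bochner_Integration.integrable_bound)
  show "integrable M (\<lambda>x. B * cmod (g x))"
    using assms(1) by simp
  show "AE x in M. norm (g x * h x) \<le> norm (B * cmod (g x))"
  proof (intro AE_I2)
    fix x
    have "cmod (g x) * cmod (h x) \<le> cmod (g x) * \<bar>B\<bar>"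
      using assms(3)[of x] by (intro mult_left_mono) auto
    then show "norm (g x * h x) \<le> norm (B * cmod (g x))"
      by (simp add: norm_mult abs_mult mult.commute)
  qed
qed (use assms in measurable)

lemma integrable_mult_circle_char_powi:
  assumes "integrable circle_lebesgue g"
  shows "integrable circle_lebesgue (\<lambda>x. g x * circle_char x powi k)"
  using assms by (rule integrable_mult_bounded[where B = 1]) (auto simp: norm_power_int)

lemma fourier_null_cmult: "fourier_null g \<Longrightarrow> fourier_null (\<lambda>x. c * g x)"
  by (simp add: fourier_null_def mult.assoc)

lemma fourier_null_add: "fourier_null g \<Longrightarrow> fourier_null h \<Longrightarrow> fourier_null (\<lambda>x. g x + h x)"
  by (simp add: fourier_null_def distrib_right integrable_mult_circle_char_powi)

text \<open>Multiplying by a character only shifts the indices of the Fourier coefficients.\<close>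

lemma fourier_null_circle_char: "fourier_null g \<Longrightarrow> fourier_null (\<lambda>x. g x * circle_char x powi m)"
  by (simp add: fourier_null_def integrable_mult_circle_char_powi mult.assoc power_int_add[symmetric])

text \<open>
  Since \<open>g\<close> is arbitrary in the induction, a product of polynomials is handled one factor at a time.
\<close>

lemma fourier_null_real_polynomial:
  assumes "real_polynomial_function p" "fourier_null g"
  shows "fourier_null (\<lambda>x. g x * of_real (p (circle_char x)))"
  using assms
proof (induction p arbitrary: g rule: real_polynomial_function.induct)
  case lin: (linear f)
  interpret bounded_linear f by fact
  \<comment> \<open>A real-linear functional on the plane has the form \<open>c z + d cnj z\<close>.
    On the unit circle \<open>cnj z\<close> is \<open>1 / z\<close>, so it is a combination of the
    characters of index 1 and -1.\<close>
  define c where "c = (of_real (f 1) - \<i> * of_real (f \<i>)) / 2"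
  define d where "d = (of_real (f 1) + \<i> * of_real (f \<i>)) / 2"
  have "of_real (f z) = c * z + d * inverse z" if "cmod z = 1" for z
  proof -
    have "f z = f (Re z *\<^sub>R 1 + Im z *\<^sub>R \<i>)"
      by (rule arg_cong[of _ _ f]) (simp add: complex_eq_iff)
    also have "\<dots> = Re z * f 1 + Im z * f \<i>"
      by (simp only: add scaleR real_scaleR_def)
    finally have "f z = Re z * f 1 + Im z * f \<i>" .
    then have "of_real (f z) = c * z + d * cnj z"
      by (simp add: c_def d_def complex_eq_iff algebra_simps add_divide_distrib diff_divide_distrib)
    moreover have "inverse z = cnj z"
      using that complex_div_cnj[of 1 z] by (simp add: inverse_eq_divide)
    ultimately show ?thesis by simp
  qed
  then have "of_real (f (circle_char x)) = c * circle_char x powi 1 + d * circle_char x powi (-1)" for x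
    by (simp add: power_int_minus)
  then have "(\<lambda>x. g x * of_real (f (circle_char x))) =
      (\<lambda>x. c * (g x * circle_char x powi 1) + d * (g x * circle_char x powi (-1)))"
    by (simp add: algebra_simps)
  then show ?case
    by (simp only:) (intro fourier_null_add fourier_null_cmult fourier_null_circle_char lin)
next
  case (const c)
  then show ?case using fourier_null_cmult[of g c] by (simp add: mult.commute)
next
  case (add f h)
  then show ?case by (simp add: distrib_left fourier_null_add)
next
  case (mult f h)
  then show ?case by (simp add: mult.assoc[symmetric])
qed

text \<open>By Stone-Weierstrass, \<open>\<phi>\<close> is uniformly within \<open>e\<close> of a
  real polynomial on the unit circle. The polynomial integrates to 0 against \<open>g\<close>, so
  the integral is at most \<open>e\<close> times the L1 norm of \<open>g\<close>.\<close>

lemma fourier_null_continuous: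
  assumes g: "fourier_null g" and cont: "continuous_on UNIV \<phi>"
  shows "(\<integral>x. g x * of_real (\<phi> (circle_char x)) \<partial>circle_lebesgue) = 0"
proof -
  have int: "integrable circle_lebesgue g"
    using g by (simp add: fourier_null_def)
  have [measurable]: "\<phi> \<in> borel_measurable borel"
    using cont by (rule borel_measurable_continuous_onI)
  have cont': "continuous_on (sphere 0 1) \<phi>"
    using cont by (rule continuous_on_subset) simp
  have "bounded (\<phi> ` sphere 0 1)"
    by (intro compact_imp_bounded compact_continuous_image cont') simp
  then obtain B where "\<And>z. z \<in> sphere 0 1 \<Longrightarrow> \<bar>\<phi> z\<bar> \<le> B"
    unfolding bounded_iff by force
  then have int\<phi>: "integrable circle_lebesgue (\<lambda>x. g x * of_real (\<phi> (circle_char x)))"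
    by (intro integrable_mult_bounded[OF int, where B = B]) auto
  let ?I = "cmod (\<integral>x. g x * of_real (\<phi> (circle_char x)) \<partial>circle_lebesgue)"
  let ?N = "\<integral>x. cmod (g x) \<partial>circle_lebesgue"
  have le: "?I \<le> e * ?N" if "e > 0" for e
  proof -
    obtain p where p: "real_polynomial_function p"
      and close: "\<And>z. z \<in> sphere 0 1 \<Longrightarrow> \<bar>\<phi> z - p z\<bar> < e"
      using Stone_Weierstrass_real_polynomial_function[OF compact_sphere cont' \<open>e > 0\<close>] by blast
    have null: "fourier_null (\<lambda>x. g x * of_real (p (circle_char x)))"
      by (rule fourier_null_real_polynomial[OF p g])
    then have intp: "integrable circle_lebesgue (\<lambda>x. g x * of_real (p (circle_char x)))"
      by (simp add: fourier_null_def)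
    \<comment> \<open>The Fourier coefficient of index 0 is the integral itself.\<close>
    have "(\<integral>x. g x * of_real (p (circle_char x)) \<partial>circle_lebesgue) = 0"
      using null unfolding fourier_null_def by (elim conjE allE[of _ 0]) simp
    then have "?I = cmod (\<integral>x. g x * of_real (\<phi> (circle_char x)) -
        g x * of_real (p (circle_char x)) \<partial>circle_lebesgue)"
      by (simp add: int\<phi> intp)
    also have "\<dots> \<le> (\<integral>x. norm (g x * of_real (\<phi> (circle_char x)) -
        g x * of_real (p (circle_char x))) \<partial>circle_lebesgue)"
      by (rule integral_norm_bound)
    also have "\<dots> \<le> (\<integral>x. e * cmod (g x) \<partial>circle_lebesgue)"
    proof (rule integral_mono)
      fix x
      have "cmod (of_real (\<phi> (circle_char x) - p (circle_char x))) \<le> e"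
        using close[of "circle_char x"] by (subst norm_of_real) simp
      then have "cmod (g x) * cmod (of_real (\<phi> (circle_char x) - p (circle_char x))) \<le> cmod (g x) * e"
        by (intro mult_left_mono) auto
      then show "norm (g x * of_real (\<phi> (circle_char x)) - g x * of_real (p (circle_char x)))
          \<le> e * cmod (g x)"
        by (simp add: right_diff_distrib[symmetric] norm_mult mult.commute of_real_diff[symmetric]
            del: of_real_diff)
    qed (use int int\<phi> intp in auto)
    finally show ?thesis by simp
  qed
  have "?N \<ge> 0" by simp
  then have pos: "0 < 1 + ?N" by linarith
  \<comment> \<open>The accuracy \<open>e / (?N + 1)\<close> is used because the L1 norm
    \<open>?N\<close> may be 0.\<close>
  have "?I \<le> 0 + e" if "e > 0" for e
  proof -
    have "?I \<le> e / (?N + 1) * ?N"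
      using \<open>?N \<ge> 0\<close> that by (intro le divide_pos_pos add_nonneg_pos) auto
    also have "\<dots> \<le> e"
      using pos that by (simp add: field_simps)
    finally show ?thesis by simp
  qed
  then have "?I \<le> 0" by (rule field_le_epsilon)
  then show ?thesis by simp
qed

text \<open>The indicator of \<open>U\<close> is the pointwise limit of the continuous functions
  \<open>min 1 (m * infdist z (- U))\<close>, and \<open>cmod (g x)\<close> dominates the
  integrands.\<close>

lemma fourier_null_open:
  assumes g: "fourier_null g" and U: "open U"
  shows "(\<integral>x. g x * of_real (indicator U (circle_char x)) \<partial>circle_lebesgue) = 0"
\<comment> \<open>The distance to the empty set is 0 by convention, so the approximating functions
  would all vanish for \<open>U = UNIV\<close>.\<close>
proof (cases "U = UNIV")
  case True
  then show ?thesis using fourier_null_continuous[OF g, of "\<lambda>_. 1"] by simp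
next
  case False
  have [measurable]: "g \<in> borel_measurable circle_lebesgue" and int: "integrable circle_lebesgue g"
    using g by (auto simp: fourier_null_def)
  define \<phi> where "\<phi> m z = min 1 (real m * infdist z (- U))" for m z
  have cont: "continuous_on UNIV (\<phi> m)" for m
    unfolding \<phi>_def by (intro continuous_intros)
  then have [measurable]: "\<phi> m \<in> borel_measurable borel" for m
    by (rule borel_measurable_continuous_onI)
  have [measurable]: "U \<in> sets borel" using U by simp
  have lim: "(\<lambda>m. \<phi> m z) \<longlonglongrightarrow> indicator U z" for z
  proof (cases "z \<in> U")
    case True
    then have "infdist z (- U) > 0"
      using False U by (intro infdist_pos_not_in_closed) auto
    then obtain M where M: "1 < real M * infdist z (- U)"
      using reals_Archimedean3 by blast
    have "\<phi> m z = 1" if "m \<ge> M" for m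
    proof -
      have "real M * infdist z (- U) \<le> real m * infdist z (- U)"
        using that by (intro mult_right_mono infdist_nonneg) simp
      then show ?thesis using M by (simp add: \<phi>_def)
    qed
    then show ?thesis
      using True by (intro tendsto_eventually eventually_sequentiallyI[of M]) simp
  next
    case False
    then show ?thesis by (simp add: \<phi>_def)
  qed
  have "(\<lambda>m. \<integral>x. g x * of_real (\<phi> m (circle_char x)) \<partial>circle_lebesgue) \<longlonglongrightarrow>
      (\<integral>x. g x * of_real (indicator U (circle_char x)) \<partial>circle_lebesgue)"
  proof (rule integral_dominated_convergence[where w = "\<lambda>x. cmod (g x)"])
    show "AE x in circle_lebesgue. (\<lambda>m. g x * of_real (\<phi> m (circle_char x)))
        \<longlonglongrightarrow> g x * of_real (indicator U (circle_char x))"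
      by (intro AE_I2 tendsto_intros lim)
    fix m
    have "0 \<le> real m * infdist z (- U)" for z
      by (simp add: infdist_nonneg)
    then have "\<bar>\<phi> m z\<bar> \<le> 1" for z
      unfolding \<phi>_def by (smt (verit))
    then show "AE x in circle_lebesgue. norm (g x * of_real (\<phi> m (circle_char x))) \<le> cmod (g x)"
      by (intro AE_I2) (simp add: norm_mult mult_left_le)
  qed (use int in auto)
  then have "(\<lambda>m. 0) \<longlonglongrightarrow> (\<integral>x. g x * of_real (indicator U (circle_char x)) \<partial>circle_lebesgue)"
    by (simp add: fourier_null_continuous[OF g cont])
  then show ?thesis
    by (metis LIMSEQ_const_iff)
qed

text \<open>The open sets are stable under intersection and generate the Borel sets. Induction from
  them shows that \<open>g\<close> integrates to 0 over the preimage of every Borel set, that is,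
  over every measurable subset of the circle.\<close>

lemma fourier_null_AE_zero:
  assumes g: "fourier_null g"
  shows "AE x in circle_lebesgue. g x = 0"
proof (rule circle_lebesgue.density_zero)
  show int: "integrable circle_lebesgue g"
    using g by (simp add: fourier_null_def)
  have preimage: "circle_char -` B \<in> sets circle_lebesgue" if "B \<in> sets borel" for B
    using measurable_sets[OF measurable_circle_char that] by simp
  \<comment> \<open>The vanishing total integral handles complements in the induction.\<close>
  have total: "(\<integral>x. g x \<partial>circle_lebesgue) = 0"
    using fourier_null_open[OF g open_UNIV] by simp
  have "(LINT x:circle_char -` B|circle_lebesgue. g x) = 0" if "B \<in> sets borel" for B
  proof -
    have "Int_stable (Collect (open :: complex set \<Rightarrow> bool))" "Collect open \<subseteq> Pow UNIV"
      by (auto simp: Int_stable_def)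
    moreover have "B \<in> sigma_sets UNIV (Collect open)"
      using that by (simp add: borel_def)
    ultimately show ?thesis
    proof (induction rule: sigma_sets_induct_disjoint)
      fix U :: "complex set" assume "U \<in> Collect open"
      then show "(LINT x:circle_char -` U|circle_lebesgue. g x) = 0"
        using fourier_null_open[OF g, of U]
        by (simp add: set_lebesgue_integral_def scaleR_conv_of_real mult.commute
            indicator_vimage indicator_def of_bool_def vimage_def)
    next
      fix B assume B: "B \<in> sigma_sets UNIV (Collect (open :: complex set \<Rightarrow> bool))"
        and 0: "(LINT x:circle_char -` B|circle_lebesgue. g x) = 0"
      have "circle_char -` B \<in> sets circle_lebesgue"
        using B by (intro preimage) (simp add: borel_def)
      then have "set_integrable circle_lebesgue (circle_char -` B) g"
        using int by (simp add: set_integrable_def integrable_mult_indicator)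
      then have "(LINT x|circle_lebesgue. g x - indicator (circle_char -` B) x *\<^sub>R g x) = 0"
        using total 0 int by (simp add: set_lebesgue_integral_def set_integrable_def)
      moreover have "g x - indicator (circle_char -` B) x *\<^sub>R g x =
          indicator (circle_char -` (UNIV - B)) x *\<^sub>R g x" for x
        by (simp add: indicator_def)
      ultimately show "(LINT x:circle_char -` (UNIV - B)|circle_lebesgue. g x) = 0"
        by (simp add: set_lebesgue_integral_def)
    next
      fix B :: "nat \<Rightarrow> complex set"
      assume disj: "disjoint_family B" and B: "range B \<subseteq> sigma_sets UNIV (Collect open)"
        and 0: "\<And>i. (LINT x:circle_char -` B i|circle_lebesgue. g x) = 0"
      have meas: "circle_char -` B i \<in> sets circle_lebesgue" for i
        using B by (intro preimage) (auto simp: borel_def)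
      then have "(\<Union>i. circle_char -` B i) \<in> sets circle_lebesgue"
        by blast
      then have "set_integrable circle_lebesgue (\<Union>i. circle_char -` B i) g"
        using int by (simp add: set_integrable_def integrable_mult_indicator)
      then have "(LINT x:(\<Union>i. circle_char -` B i)|circle_lebesgue. g x) =
          (\<Sum>i. LINT x:circle_char -` B i|circle_lebesgue. g x)"
        using disj meas
        by (intro lebesgue_integral_countable_add) (auto simp: disjoint_family_on_def)
      then show "(LINT x:circle_char -` \<Union> (range B)|circle_lebesgue. g x) = 0"
        by (simp add: 0 vimage_UN)
    qed (simp add: set_lebesgue_integral_def)
  qed
  then show "set_lebesgue_integral circle_lebesgue A g = 0" if "A \<in> sets circle_lebesgue" for A
    using that by (metis sets_circle_eq_vimage)
qed

text \<open>Rotation invariance multiplies the integral of \<open>f\<close> against the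
  \<open>k\<close>-th character by \<open>\<kappa> * circle_char t powi k\<close>. If no such factor
  equals 1, all Fourier coefficients of \<open>f\<close> vanish and \<open>f = 0\<close> almost
  everywhere, a contradiction.\<close>

lemma rotation_eigenvalue:
  assumes int: "integrable circle_lebesgue f"
    and nonzero: "AE x in circle_lebesgue. f x \<noteq> 0"
    and eq: "AE x in circle_lebesgue. f x = \<kappa> * f (x - t)"
  shows "\<exists>k::int. \<kappa> = circle_char t powi k"
proof (rule ccontr)
  assume no: "\<not> ?thesis"
  have "(\<integral>x. f x * circle_char x powi k \<partial>circle_lebesgue) = 0" for k
  proof -
    let ?I = "\<integral>x. f x * circle_char x powi k \<partial>circle_lebesgue"
    have [measurable]: "f \<in> borel_measurable circle_lebesgue"
      using int by simp
    have meas: "(\<lambda>x. f x * circle_char x powi k) \<in> borel_measurable circle_lebesgue" by measurable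
    have shift: "(\<lambda>x. f (x - t) * circle_char (x - t) powi k) \<in> borel_measurable circle_lebesgue"
      by (rule measurable_compose[OF measurable_circle_diff meas])
    have "?I = (\<integral>x. (\<kappa> * circle_char t powi k) * (f (x - t) * circle_char (x - t) powi k) \<partial>circle_lebesgue)"
    proof (rule integral_cong_AE)
      show "AE x in circle_lebesgue. f x * circle_char x powi k =
          (\<kappa> * circle_char t powi k) * (f (x - t) * circle_char (x - t) powi k)"
        using eq by eventually_elim
          (simp add: circle_char_diff power_int_divide_distrib)
    qed (use meas shift in measurable)
    also have "\<dots> = (\<kappa> * circle_char t powi k) * ?I"
      using integral_circle_add[OF meas, of "- t"] by simp
    finally have "(1 - \<kappa> * circle_char t powi k) * ?I = 0"
      by (simp add: algebra_simps)
    moreover have "\<kappa> * circle_char t powi k \<noteq> 1"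
    proof
      assume "\<kappa> * circle_char t powi k = 1"
      then have "\<kappa> = circle_char t powi (- k)"
        by (simp add: power_int_minus field_simps)
      then show False using no by blast
    qed
    ultimately show ?thesis by simp
  qed
  then have "AE x in circle_lebesgue. f x = 0"
    using int by (intro fourier_null_AE_zero) (simp add: fourier_null_def)
  with nonzero have "AE x in circle_lebesgue. False"
    by eventually_elim simp
  then show False
    using emeasure_eq_0_AE[of "\<lambda>_. True" circle_lebesgue] by (simp add: emeasure_circle_lebesgue_UNIV)
qed

subsection \<open>Operators induced by maps on functions\<close>

lemma borel_measurable_cnj [measurable (raw)]:
  "f \<in> borel_measurable M \<Longrightarrow> (\<lambda>x. cnj (f x)) \<in> borel_measurable M"
  by (erule measurable_compose) (intro borel_measurable_continuous_onI continuous_on_cnj continuous_on_id)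

text \<open>This and the next definition isolate the conditions on single entries in
  \<open>L2_fun\<close> and \<open>Linf_fun\<close>, so that closure properties need proof for
  scalar functions only.\<close>

definition square_integrable :: "'a measure \<Rightarrow> ('a \<Rightarrow> complex) \<Rightarrow> bool" where
  "square_integrable M f \<longleftrightarrow> f \<in> borel_measurable M \<and> integrable M (\<lambda>x. (cmod (f x))\<^sup>2)"

definition ess_bounded :: "'a measure \<Rightarrow> ('a \<Rightarrow> complex) \<Rightarrow> bool" where
  "ess_bounded M f \<longleftrightarrow> f \<in> borel_measurable M \<and> (\<exists>B. AE x in M. cmod (f x) \<le> B)"

lemma square_integrable_add:
  assumes f: "square_integrable M f" and g: "square_integrable M g"
  shows "square_integrable M (\<lambda>x. f x + g x)"
  unfolding square_integrable_def
proof
  have [measurable]: "f \<in> borel_measurable M" "g \<in> borel_measurable M"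
    using assms by (simp_all add: square_integrable_def)
  show "(\<lambda>x. f x + g x) \<in> borel_measurable M" by measurable
  show "integrable M (\<lambda>x. (cmod (f x + g x))\<^sup>2)"
  proof (rule Bochner_Integration.integrable_bound)
    show "integrable M (\<lambda>x. 2 * (cmod (f x))\<^sup>2 + 2 * (cmod (g x))\<^sup>2)"
      using assms by (simp add: square_integrable_def)
    show "AE x in M. norm ((cmod (f x + g x))\<^sup>2) \<le> norm (2 * (cmod (f x))\<^sup>2 + 2 * (cmod (g x))\<^sup>2)"
    proof (rule AE_I2)
      fix x
      have "(cmod (f x + g x))\<^sup>2 \<le> (cmod (f x) + cmod (g x))\<^sup>2"
        by (intro power_mono norm_triangle_ineq) simp
      also have "\<dots> \<le> 2 * (cmod (f x))\<^sup>2 + 2 * (cmod (g x))\<^sup>2"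
        using sum_squares_bound[of "cmod (f x)" "cmod (g x)"] by (simp add: power2_sum)
      finally show "norm ((cmod (f x + g x))\<^sup>2) \<le> norm (2 * (cmod (f x))\<^sup>2 + 2 * (cmod (g x))\<^sup>2)"
        by simp
    qed
  qed measurable
qed

lemma square_integrable_sum:
  assumes "\<And>i. i \<in> I \<Longrightarrow> square_integrable M (f i)"
  shows "square_integrable M (\<lambda>x. \<Sum>i\<in>I. f i x)"
  using assms
proof (induction I rule: infinite_finite_induct)
  case (insert i I)
  then show ?case by (simp add: square_integrable_add)
qed (simp_all add: square_integrable_def)

lemma square_integrable_mult_ess_bounded:
  assumes h: "ess_bounded M h" and f: "square_integrable M f"
  shows "square_integrable M (\<lambda>x. h x * f x)"
  unfolding square_integrable_def
proof
  have [measurable]: "f \<in> borel_measurable M" "h \<in> borel_measurable M"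
    using assms by (simp_all add: square_integrable_def ess_bounded_def)
  show "(\<lambda>x. h x * f x) \<in> borel_measurable M" by measurable
  obtain B where B: "AE x in M. cmod (h x) \<le> B"
    using h by (auto simp: ess_bounded_def)
  show "integrable M (\<lambda>x. (cmod (h x * f x))\<^sup>2)"
  proof (rule Bochner_Integration.integrable_bound)
    show "integrable M (\<lambda>x. B\<^sup>2 * (cmod (f x))\<^sup>2)"
      using f by (simp add: square_integrable_def)
    show "AE x in M. norm ((cmod (h x * f x))\<^sup>2) \<le> norm (B\<^sup>2 * (cmod (f x))\<^sup>2)"
      using B
    proof eventually_elim
      case (elim x)
      then have "(cmod (h x))\<^sup>2 * (cmod (f x))\<^sup>2 \<le> B\<^sup>2 * (cmod (f x))\<^sup>2"
        by (intro mult_right_mono power_mono) auto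
      then show ?case by (simp add: norm_mult power_mult_distrib)
    qed
  qed measurable
qed

lemma square_integrable_const: "square_integrable circle_lebesgue (\<lambda>x. c)"
  by (simp add: square_integrable_def)

lemma square_integrable_uminus: "square_integrable M f \<Longrightarrow> square_integrable M (\<lambda>x. - f x)"
  by (simp add: square_integrable_def)

lemma square_integrable_diff:
  "square_integrable M f \<Longrightarrow> square_integrable M g \<Longrightarrow> square_integrable M (\<lambda>x. f x - g x)"
  using square_integrable_add[of M f "\<lambda>x. - g x"] by (simp add: square_integrable_uminus)

lemma integrable_mult_cnj:
  assumes f: "square_integrable M f" and g: "square_integrable M g"
  shows "integrable M (\<lambda>x. f x * cnj (g x))"
proof (rule Bochner_Integration.integrable_bound)
  have [measurable]: "f \<in> borel_measurable M" "g \<in> borel_measurable M"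
    using assms by (simp_all add: square_integrable_def)
  show "(\<lambda>x. f x * cnj (g x)) \<in> borel_measurable M" by measurable
  show "integrable M (\<lambda>x. (cmod (f x))\<^sup>2 + (cmod (g x))\<^sup>2)"
    using assms by (simp add: square_integrable_def)
  have "a * b \<le> a\<^sup>2 + b\<^sup>2" if "a \<ge> 0" "b \<ge> 0" for a b :: real
    using sum_squares_bound[of a b] mult_nonneg_nonneg[OF that] by linarith
  then show "AE x in M. norm (f x * cnj (g x)) \<le> norm ((cmod (f x))\<^sup>2 + (cmod (g x))\<^sup>2)"
    by (simp add: norm_mult)
qed

lemma ess_bounded_mult:
  assumes "ess_bounded M f" "ess_bounded M g"
  shows "ess_bounded M (\<lambda>x. f x * g x)"
proof -
  obtain B C where "AE x in M. cmod (f x) \<le> B" "AE x in M. cmod (g x) \<le> C"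
    using assms by (auto simp: ess_bounded_def)
  then have "AE x in M. cmod (f x * g x) \<le> B * C"
  proof eventually_elim
    case (elim x)
    \<comment> \<open>Nothing is known about the sign of an essential bound in advance; the
      inequality at \<open>x\<close> itself forces \<open>B\<close> to be nonnegative.\<close>
    have "0 \<le> B" using elim(1) norm_ge_zero order_trans by blast
    with elim show ?case by (simp add: norm_mult mult_mono)
  qed
  then show ?thesis using assms by (auto simp: ess_bounded_def)
qed

lemma ess_bounded_add:
  assumes "ess_bounded M f" "ess_bounded M g"
  shows "ess_bounded M (\<lambda>x. f x + g x)"
proof -
  obtain B C where "AE x in M. cmod (f x) \<le> B" "AE x in M. cmod (g x) \<le> C"
    using assms by (auto simp: ess_bounded_def)
  then have "AE x in M. cmod (f x + g x) \<le> B + C"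
    by eventually_elim (rule norm_triangle_le, simp)
  then show ?thesis using assms by (auto simp: ess_bounded_def)
qed

lemma ess_bounded_const: "ess_bounded M (\<lambda>x. c)"
  by (auto simp: ess_bounded_def)

lemma ess_bounded_sum:
  assumes "\<And>i. i \<in> I \<Longrightarrow> ess_bounded M (f i)"
  shows "ess_bounded M (\<lambda>x. \<Sum>i\<in>I. f i x)"
  using assms
proof (induction I rule: infinite_finite_induct)
  case (insert i I)
  then show ?case by (simp add: ess_bounded_add)
qed (simp_all add: ess_bounded_const)

lemma ess_bounded_cnj: "ess_bounded M f \<Longrightarrow> ess_bounded M (\<lambda>x. cnj (f x))"
  by (simp add: ess_bounded_def borel_measurable_cnj)

lemma ess_bounded_circle_diff:
  assumes "ess_bounded circle_lebesgue f"
  shows "ess_bounded circle_lebesgue (\<lambda>x. f (x - t))"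
proof -
  obtain B where "AE x in circle_lebesgue. cmod (f x) \<le> B"
    using assms by (auto simp: ess_bounded_def)
  from AE_circle_add[OF this, of "- t"] have "AE x in circle_lebesgue. cmod (f (x - t)) \<le> B"
    by simp
  moreover have "(\<lambda>x. f (x - t)) \<in> borel_measurable circle_lebesgue"
    using assms by (intro measurable_compose[OF measurable_circle_diff]) (simp add: ess_bounded_def)
  ultimately show ?thesis
    by (auto simp: ess_bounded_def)
qed

section \<open>Vector-valued and matrix-valued functions by entries\<close>

lemma L2_fun_iff:
  "\<xi> \<in> L2_fun n \<longleftrightarrow> (\<forall>x. \<xi> x \<in> carrier_vec n) \<and>
     (\<forall>i<n. square_integrable circle_lebesgue (\<lambda>x. vec_index (\<xi> x) i))"
  by (simp add: L2_fun_def square_integrable_def)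

lemma Linf_fun_iff:
  "F \<in> Linf_fun n \<longleftrightarrow> (\<forall>x. F x \<in> carrier_mat n n) \<and>
     (\<forall>i<n. \<forall>j<n. ess_bounded circle_lebesgue (\<lambda>x. F x $$ (i, j)))"
  by (simp add: Linf_fun_def ess_bounded_def)

lemma mult_mat_vec_index:
  assumes "A \<in> carrier_mat n n" "v \<in> carrier_vec n" "i < n"
  shows "vec_index (A *\<^sub>v v) i = (\<Sum>j<n. A $$ (i, j) * vec_index v j)"
  using assms by (simp add: scalar_prod_def atLeast0LessThan)

lemma cscalar_prod_eq_sum:
  assumes "v \<in> carrier_vec n" "w \<in> carrier_vec n"
  shows "v \<bullet>c w = (\<Sum>i<n. vec_index v i * cnj (vec_index w i))"
  using assms by (simp add: scalar_prod_def atLeast0LessThan)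

lemma cscalar_prod_mat_adjoint:
  assumes A: "A \<in> carrier_mat n n" and v: "v \<in> carrier_vec n" and w: "w \<in> carrier_vec n"
  shows "(A *\<^sub>v v) \<bullet>c w = v \<bullet>c (mat_adjoint A *\<^sub>v (w :: complex Matrix.vec))"
proof -
  have "(A *\<^sub>v v) \<bullet>c w = (\<Sum>i<n. \<Sum>j<n. A $$ (i, j) * vec_index v j * cnj (vec_index w i))"
    unfolding cscalar_prod_eq_sum[OF mult_mat_vec_carrier[OF A v] w]
    by (intro sum.cong) (simp_all add: mult_mat_vec_index[OF A v] sum_distrib_right del: index_mult_mat_vec)
  also have "\<dots> = (\<Sum>j<n. \<Sum>i<n. A $$ (i, j) * vec_index v j * cnj (vec_index w i))"
    by (rule sum.swap)
  also have "\<dots> = (\<Sum>j<n. vec_index v j * cnj (vec_index (mat_adjoint A *\<^sub>v w) j))"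
  proof (rule sum.cong)
    fix j assume j: "j \<in> {..<n}"
    then have "vec_index (mat_adjoint A *\<^sub>v w) j = (\<Sum>i<n. cnj (A $$ (i, j)) * vec_index w i)"
      by (subst mult_mat_vec_index[OF mat_adjoint_carrier[OF A] w])
        (auto simp: mat_adjoint_index[OF A])
    then show "(\<Sum>i<n. A $$ (i, j) * vec_index v j * cnj (vec_index w i)) =
        vec_index v j * cnj (vec_index (mat_adjoint A *\<^sub>v w) j)"
      by (simp add: sum_distrib_left mult_ac)
  qed simp
  also have "\<dots> = v \<bullet>c (mat_adjoint A *\<^sub>v w)"
    using mat_adjoint_carrier[OF A] v w by (subst cscalar_prod_eq_sum) (auto simp: mult_mat_vec_carrier)
  finally show ?thesis .
qed

section \<open>Classes modulo null sets and induced operators\<close>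

lemma equiv_ae_eq: "equiv (L2_fun n) (ae_eq n)"
proof (rule equivI)
  show "trans (ae_eq n)"
    unfolding trans_def ae_eq_def by (auto elim: AE_mp)
qed (auto simp: ae_eq_def refl_on_def sym_def elim: AE_mp)

abbreviation L2_class :: "nat \<Rightarrow> (circle \<Rightarrow> complex Matrix.vec) \<Rightarrow> (circle \<Rightarrow> complex Matrix.vec) set" where
  "L2_class n \<xi> \<equiv> ae_eq n `` {\<xi>}"

lemma L2_class_in [simp]: "\<xi> \<in> L2_fun n \<Longrightarrow> L2_class n \<xi> \<in> L2 n"
  unfolding L2_def by (rule quotientI)

lemma L2_cases:
  assumes "X \<in> L2 n"
  obtains \<xi> where "\<xi> \<in> L2_fun n" "X = L2_class n \<xi>"
  using assms unfolding L2_def by (auto elim: quotientE)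

lemma L2_class_eq_iff:
  "\<xi> \<in> L2_fun n \<Longrightarrow> \<eta> \<in> L2_fun n \<Longrightarrow>
     L2_class n \<xi> = L2_class n \<eta> \<longleftrightarrow> (AE x in circle_lebesgue. \<xi> x = \<eta> x)"
  by (simp add: eq_equiv_class_iff[OF equiv_ae_eq]) (simp add: ae_eq_def)

text \<open>Since \<open>ae_eq\<close> relates only members of \<open>L2_fun\<close>, the condition
  on the pairs \<open>(\<xi>, \<xi>)\<close> includes that \<open>T\<close> preserves
  \<open>L2_fun\<close>.\<close>

definition respects_ae :: "nat \<Rightarrow> ((circle \<Rightarrow> complex Matrix.vec) \<Rightarrow> (circle \<Rightarrow> complex Matrix.vec)) \<Rightarrow> bool" where
  "respects_ae n T \<longleftrightarrow> (\<forall>\<xi> \<eta>. (\<xi>, \<eta>) \<in> ae_eq n \<longrightarrow> (T \<xi>, T \<eta>) \<in> ae_eq n)"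

lemma respects_aeI:
  assumes "\<And>\<xi>. \<xi> \<in> L2_fun n \<Longrightarrow> T \<xi> \<in> L2_fun n"
    and "\<And>\<xi> \<eta>. AE x in circle_lebesgue. \<xi> x = \<eta> x \<Longrightarrow> AE x in circle_lebesgue. T \<xi> x = T \<eta> x"
  shows "respects_ae n T"
  using assms by (auto simp: respects_ae_def ae_eq_def)

lemma respects_ae_L2_fun: "respects_ae n T \<Longrightarrow> \<xi> \<in> L2_fun n \<Longrightarrow> T \<xi> \<in> L2_fun n"
  unfolding respects_ae_def ae_eq_def by force

lemma respects_ae_comp: "respects_ae n S \<Longrightarrow> respects_ae n T \<Longrightarrow> respects_ae n (\<lambda>\<xi>. S (T \<xi>))"
  by (simp add: respects_ae_def)

text \<open>All members of the class yield the same class under \<open>T\<close>, so the union in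
  \<open>induced_op\<close> collapses to a single class.\<close>

lemma induced_op_class:
  assumes "respects_ae n T" "\<xi> \<in> L2_fun n"
  shows "induced_op n T (L2_class n \<xi>) = L2_class n (T \<xi>)"
proof -
  have "(\<lambda>\<xi>. L2_class n (T \<xi>)) respects (ae_eq n)"
  proof (rule congruentI)
    fix \<xi> \<eta> assume "(\<xi>, \<eta>) \<in> ae_eq n"
    then have "(T \<xi>, T \<eta>) \<in> ae_eq n"
      using assms(1) by (simp add: respects_ae_def)
    then show "L2_class n (T \<xi>) = L2_class n (T \<eta>)"
      by (rule equiv_class_eq[OF equiv_ae_eq])
  qed
  from UN_equiv_class[OF equiv_ae_eq this assms(2)] show ?thesis
    using assms(2) by (simp add: induced_op_def)
qed

lemma induced_op_in:
  assumes "respects_ae n T"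
  shows "induced_op n T \<in> L2 n \<rightarrow>\<^sub>E L2 n"
proof
  fix X assume "X \<in> L2 n"
  then show "induced_op n T X \<in> L2 n"
    by (elim L2_cases) (simp add: induced_op_class assms respects_ae_L2_fun)
qed (simp add: induced_op_def)

lemma L2_op_eqI:
  assumes "S \<in> extensional (L2 n)" "T \<in> extensional (L2 n)"
    and "\<And>\<xi>. \<xi> \<in> L2_fun n \<Longrightarrow> S (L2_class n \<xi>) = T (L2_class n \<xi>)"
  shows "S = T"
  using assms(1,2) by (rule extensionalityI) (elim L2_cases, simp add: assms(3))

lemma induced_op_extensional: "induced_op n T \<in> extensional (L2 n)"
  by (simp add: induced_op_def)

lemma op_mult_induced_op:
  assumes "respects_ae n S" "respects_ae n T"
  shows "op_mult n (induced_op n S) (induced_op n T) = induced_op n (\<lambda>\<xi>. S (T \<xi>))"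
proof (rule L2_op_eqI)
  have "respects_ae n (\<lambda>\<xi>. S (T \<xi>))"
    using assms by (simp add: respects_ae_def)
  then show "op_mult n (induced_op n S) (induced_op n T) (L2_class n \<xi>) =
      induced_op n (\<lambda>\<xi>. S (T \<xi>)) (L2_class n \<xi>)" if "\<xi> \<in> L2_fun n" for \<xi>
    using that assms by (simp add: op_mult_def compose_def induced_op_class respects_ae_L2_fun)
qed (simp_all add: op_mult_def induced_op_extensional)

lemma induced_op_eq_iff:
  assumes "respects_ae n S" "respects_ae n T"
  shows "induced_op n S = induced_op n T \<longleftrightarrow>
    (\<forall>\<xi>\<in>L2_fun n. AE x in circle_lebesgue. S \<xi> x = T \<xi> x)" (is "?L \<longleftrightarrow> ?R")
proof
  assume ?L
  show ?R
  proof
    fix \<xi> assume \<xi>: "\<xi> \<in> L2_fun n"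
    then have "L2_class n (S \<xi>) = L2_class n (T \<xi>)"
      using assms \<open>?L\<close> by (metis induced_op_class)
    then show "AE x in circle_lebesgue. S \<xi> x = T \<xi> x"
      using assms \<xi> by (simp add: L2_class_eq_iff respects_ae_L2_fun)
  qed
next
  assume ?R
  then show ?L
    using assms by (intro L2_op_eqI[of _ n])
      (simp_all add: induced_op_extensional induced_op_class L2_class_eq_iff respects_ae_L2_fun)
qed

section \<open>The inner product and adjoints\<close>

lemma measurable_cscalar_prod:
  assumes "\<xi> \<in> L2_fun n" "\<eta> \<in> L2_fun n"
  shows "(\<lambda>x. \<xi> x \<bullet>c \<eta> x) \<in> borel_measurable circle_lebesgue"
proof -
  have "(\<lambda>x. \<Sum>i<n. vec_index (\<xi> x) i * cnj (vec_index (\<eta> x) i)) \<in> borel_measurable circle_lebesgue"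
    using assms by (auto simp: L2_fun_def intro!: borel_measurable_sum borel_measurable_times)
  then show ?thesis
    using assms by (subst cscalar_prod_eq_sum[where n = n]) (auto simp: L2_fun_def)
qed

text \<open>The representatives picked by \<open>SOME\<close> agree almost everywhere with the given
  ones.\<close>

lemma L2_inner_class:
  assumes "\<xi> \<in> L2_fun n" "\<eta> \<in> L2_fun n"
  shows "L2_inner (L2_class n \<xi>) (L2_class n \<eta>) = (\<integral>x. \<xi> x \<bullet>c \<eta> x \<partial>circle_lebesgue)"
proof -
  define \<xi>' where "\<xi>' = (SOME \<xi>'. \<xi>' \<in> L2_class n \<xi>)"
  define \<eta>' where "\<eta>' = (SOME \<eta>'. \<eta>' \<in> L2_class n \<eta>)"
  have "\<xi>' \<in> L2_class n \<xi>" "\<eta>' \<in> L2_class n \<eta>"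
    unfolding \<xi>'_def \<eta>'_def some_in_eq using assms equiv_class_self[OF equiv_ae_eq] by blast+
  then have *: "(\<xi>, \<xi>') \<in> ae_eq n" "(\<eta>, \<eta>') \<in> ae_eq n" by auto
  have "AE x in circle_lebesgue. \<xi> x = \<xi>' x" "AE x in circle_lebesgue. \<eta> x = \<eta>' x"
    using * by (auto simp: ae_eq_def)
  then have "AE x in circle_lebesgue. \<xi>' x \<bullet>c \<eta>' x = \<xi> x \<bullet>c \<eta> x"
    by eventually_elim simp
  then show ?thesis
    unfolding L2_inner_def \<xi>'_def[symmetric] \<eta>'_def[symmetric] using *
    by (intro integral_cong_AE measurable_cscalar_prod[of _ n]) (auto simp: ae_eq_def)
qed

lemma integrable_cscalar_prod:
  assumes "\<xi> \<in> L2_fun n" "\<eta> \<in> L2_fun n"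
  shows "integrable circle_lebesgue (\<lambda>x. \<xi> x \<bullet>c \<eta> x)"
proof -
  have "integrable circle_lebesgue (\<lambda>x. \<Sum>i<n. vec_index (\<xi> x) i * cnj (vec_index (\<eta> x) i))"
    using assms by (intro Bochner_Integration.integrable_sum integrable_mult_cnj) (auto simp: L2_fun_iff)
  then show ?thesis
    using assms by (subst cscalar_prod_eq_sum[where n = n]) (auto simp: L2_fun_def)
qed

lemma L2_fun_diff:
  assumes "\<xi> \<in> L2_fun n" "\<eta> \<in> L2_fun n"
  shows "(\<lambda>x. \<xi> x - \<eta> x) \<in> L2_fun n"
proof -
  have "vec_index (\<xi> x - \<eta> x) i = vec_index (\<xi> x) i - vec_index (\<eta> x) i" if "i < n" for x i
  proof -
    have "dim_vec (\<eta> x) = n" using assms(2) by (intro carrier_vecD) (simp add: L2_fun_iff)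
    then show ?thesis using that by simp
  qed
  then show ?thesis
    using assms by (auto simp: L2_fun_iff square_integrable_diff)
qed

text \<open>Testing against the difference of \<open>Y\<close> and \<open>Z\<close> gives its
  squared norm, which must be 0. This is what makes an adjoint unique.\<close>

lemma L2_inner_nondegenerate:
  assumes "Y \<in> L2 n" "Z \<in> L2 n" and eq: "\<And>X. X \<in> L2 n \<Longrightarrow> L2_inner X Y = L2_inner X Z"
  shows "Y = Z"
proof -
  obtain \<alpha> \<beta> where \<alpha>: "\<alpha> \<in> L2_fun n" "Y = L2_class n \<alpha>" and \<beta>: "\<beta> \<in> L2_fun n" "Z = L2_class n \<beta>"
    using assms(1,2) by (meson L2_cases)
  define \<delta> where "\<delta> x = \<alpha> x - \<beta> x" for x
  have \<delta>: "\<delta> \<in> L2_fun n"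
    unfolding \<delta>_def using \<alpha> \<beta> by (intro L2_fun_diff)
  have carrier: "\<alpha> x \<in> carrier_vec n" "\<beta> x \<in> carrier_vec n" "\<delta> x \<in> carrier_vec n" for x
    using \<alpha> \<beta> \<delta> by (auto simp: L2_fun_def)
  \<comment> \<open>The pointwise squared norm of \<open>\<delta>\<close> is kept real-valued, so
    that a vanishing integral of a nonnegative function can be exploited.\<close>
  define h where "h x = (\<Sum>i<n. (cmod (vec_index (\<delta> x) i))\<^sup>2)" for x
  have h: "\<delta> x \<bullet>c \<alpha> x - \<delta> x \<bullet>c \<beta> x = of_real (h x)" for x
  proof -
    have "\<delta> x \<bullet>c \<alpha> x - \<delta> x \<bullet>c \<beta> x = (\<Sum>i<n. vec_index (\<delta> x) i * cnj (vec_index (\<delta> x) i))"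
      using carrier[of x]
      by (auto simp: cscalar_prod_eq_sum[of _ n] sum_subtractf[symmetric] right_diff_distrib[symmetric]
          \<delta>_def intro!: sum.cong)
    then show ?thesis
      by (simp add: h_def complex_norm_square[symmetric])
  qed
  have inth: "integrable circle_lebesgue h"
    unfolding h_def using \<delta> by (auto simp: L2_fun_iff square_integrable_def)
  have "of_real (\<integral>x. h x \<partial>circle_lebesgue) = (\<integral>x. \<delta> x \<bullet>c \<alpha> x - \<delta> x \<bullet>c \<beta> x \<partial>circle_lebesgue)"
    by (simp add: h)
  also have "\<dots> = L2_inner (L2_class n \<delta>) Y - L2_inner (L2_class n \<delta>) Z"
    using \<alpha> \<beta> \<delta> by (simp add: L2_inner_class integrable_cscalar_prod)
  also have "\<dots> = 0"
    using eq \<delta> by simp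
  finally have "(\<integral>x. h x \<partial>circle_lebesgue) = 0" by simp
  then have "AE x in circle_lebesgue. h x = 0"
    using inth by (subst (asm) integral_nonneg_eq_0_iff_AE) (auto simp: h_def sum_nonneg)
  then have "AE x in circle_lebesgue. \<alpha> x = \<beta> x"
  proof eventually_elim
    case (elim x)
    then have "\<forall>i<n. vec_index (\<delta> x) i = 0"
      by (auto simp: h_def sum_nonneg_eq_0_iff)
    then show ?case
      using carrier[of x] by (intro eq_vecI) (auto simp: \<delta>_def)
  qed
  then show ?thesis
    using \<alpha> \<beta> by (simp add: L2_class_eq_iff)
qed

text \<open>Evaluates the definite description in \<open>op_adjoint\<close>: the integral identity
  shows that \<open>T\<close> induces an adjoint, and nondegeneracy of the inner product excludes
  any other.\<close>

lemma op_adjoint_induced_op: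
  assumes S: "respects_ae n S" and T: "respects_ae n T"
    and adj: "\<And>\<xi> \<eta>. \<xi> \<in> L2_fun n \<Longrightarrow> \<eta> \<in> L2_fun n \<Longrightarrow>
      (\<integral>x. S \<xi> x \<bullet>c \<eta> x \<partial>circle_lebesgue) = (\<integral>x. \<xi> x \<bullet>c T \<eta> x \<partial>circle_lebesgue)"
  shows "op_adjoint n (induced_op n S) = induced_op n T"
  unfolding op_adjoint_def
proof (rule the_equality)
  have *: "L2_inner (induced_op n S X) Y = L2_inner X (induced_op n T Y)"
    if "X \<in> L2 n" "Y \<in> L2 n" for X Y
    using that by (elim L2_cases) (simp add: induced_op_class S T L2_inner_class respects_ae_L2_fun adj)
  then show "induced_op n T \<in> L2 n \<rightarrow>\<^sub>E L2 n \<and>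
      (\<forall>X\<in>L2 n. \<forall>Y\<in>L2 n. L2_inner (induced_op n S X) Y = L2_inner X (induced_op n T Y))"
    using induced_op_in[OF T] by blast
  fix R assume R: "R \<in> L2 n \<rightarrow>\<^sub>E L2 n \<and>
      (\<forall>X\<in>L2 n. \<forall>Y\<in>L2 n. L2_inner (induced_op n S X) Y = L2_inner X (R Y))"
  show "R = induced_op n T"
  proof (rule extensionalityI[of _ "L2 n"])
    fix Y assume Y: "Y \<in> L2 n"
    show "R Y = induced_op n T Y"
    proof (rule L2_inner_nondegenerate)
      show "R Y \<in> L2 n" "induced_op n T Y \<in> L2 n"
        using R Y induced_op_in[OF T] by auto
      show "L2_inner X (R Y) = L2_inner X (induced_op n T Y)" if "X \<in> L2 n" for X
        using R Y that * by metis
    qed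
  qed (use R induced_op_extensional in \<open>auto simp: PiE_def\<close>)
qed

section \<open>Multiplication operators and rotations\<close>

lemma respects_ae_mult:
  assumes F: "F \<in> Linf_fun n"
  shows "respects_ae n (\<lambda>\<xi> x. F x *\<^sub>v \<xi> x)"
proof (rule respects_aeI)
  fix \<xi> assume \<xi>: "\<xi> \<in> L2_fun n"
  have "vec_index (F x *\<^sub>v \<xi> x) i = (\<Sum>j<n. F x $$ (i, j) * vec_index (\<xi> x) j)" if "i < n" for i x
    using F \<xi> that by (intro mult_mat_vec_index) (auto simp: L2_fun_iff Linf_fun_iff)
  moreover have "F x *\<^sub>v \<xi> x \<in> carrier_vec n" for x
    using F \<xi> by (intro mult_mat_vec_carrier) (auto simp: L2_fun_iff Linf_fun_iff)
  ultimately show "(\<lambda>x. F x *\<^sub>v \<xi> x) \<in> L2_fun n"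
    using F \<xi> unfolding L2_fun_iff Linf_fun_iff
    by (auto intro!: square_integrable_sum square_integrable_mult_ess_bounded)
next
  fix \<xi> \<eta> :: "circle \<Rightarrow> complex Matrix.vec"
  assume "AE x in circle_lebesgue. \<xi> x = \<eta> x"
  then show "AE x in circle_lebesgue. F x *\<^sub>v \<xi> x = F x *\<^sub>v \<eta> x"
    by eventually_elim simp
qed

lemma respects_ae_shift: "respects_ae n (\<lambda>\<xi> x. \<xi> (x + t))"
proof (rule respects_aeI)
  fix \<xi> assume \<xi>: "\<xi> \<in> L2_fun n"
  have "square_integrable circle_lebesgue (\<lambda>x. f (x + t))"
    if "square_integrable circle_lebesgue f" for f
    using that integrable_circle_add[of "\<lambda>x. (cmod (f x))\<^sup>2" t]
    by (auto simp: square_integrable_def intro: measurable_compose[OF measurable_circle_add[of t]])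
  then show "(\<lambda>x. \<xi> (x + t)) \<in> L2_fun n"
    using \<xi> unfolding L2_fun_iff by blast
next
  fix \<xi> \<eta> :: "circle \<Rightarrow> complex Matrix.vec"
  assume "AE x in circle_lebesgue. \<xi> x = \<eta> x"
  then show "AE x in circle_lebesgue. \<xi> (x + t) = \<eta> (x + t)"
    by (rule AE_circle_add)
qed

lemma Linf_fun_adjoint:
  assumes F: "F \<in> Linf_fun n"
  shows "(\<lambda>x. mat_adjoint (F x)) \<in> Linf_fun n"
proof -
  have carrier: "F x \<in> carrier_mat n n" for x
    using F by (simp add: Linf_fun_iff)
  with F show ?thesis
    by (simp add: Linf_fun_iff mat_adjoint_carrier mat_adjoint_index[OF carrier] ess_bounded_cnj)
qed

lemma Linf_fun_mult:
  assumes F: "F \<in> Linf_fun n" and G: "G \<in> Linf_fun n"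
  shows "(\<lambda>x. F x * G x) \<in> Linf_fun n"
proof -
  have carrier: "F x \<in> carrier_mat n n" "G x \<in> carrier_mat n n" for x
    using F G by (simp_all add: Linf_fun_iff)
  have entry: "(F x * G x) $$ (i, j) = (\<Sum>k\<in>{0..<n}. F x $$ (i, k) * G x $$ (k, j))"
    if "i < n" "j < n" for x i j
    by (rule mat_mult_index[OF carrier that])
  have "F x * G x \<in> carrier_mat n n" for x
    using carrier by (rule mult_carrier_mat)
  moreover have "ess_bounded circle_lebesgue (\<lambda>x. (F x * G x) $$ (i, j))" if "i < n" "j < n" for i j
    unfolding entry[OF that] using F G that
    by (intro ess_bounded_sum ess_bounded_mult) (auto simp: Linf_fun_iff)
  ultimately show ?thesis
    unfolding Linf_fun_iff by blast
qed

lemma Linf_fun_shift: "F \<in> Linf_fun n \<Longrightarrow> (\<lambda>x. F (x - t)) \<in> Linf_fun n"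
  unfolding Linf_fun_iff using ess_bounded_circle_diff by blast

lemma Linf_fun_const: "A \<in> carrier_mat n n \<Longrightarrow> (\<lambda>x. A) \<in> Linf_fun n"
  by (simp add: Linf_fun_iff ess_bounded_const)

lemma mult_op_eq_iff:
  assumes F: "F \<in> Linf_fun n" and G: "G \<in> Linf_fun n"
  shows "mult_op n F = mult_op n G \<longleftrightarrow> (AE x in circle_lebesgue. F x = G x)"
proof
  have carrier: "F x \<in> carrier_mat n n" "G x \<in> carrier_mat n n" for x
    using F G by (simp_all add: Linf_fun_iff)
  have iff: "mult_op n F = mult_op n G \<longleftrightarrow>
      (\<forall>\<xi>\<in>L2_fun n. AE x in circle_lebesgue. F x *\<^sub>v \<xi> x = G x *\<^sub>v \<xi> x)"
    unfolding mult_op_def by (rule induced_op_eq_iff) (rule respects_ae_mult F G)+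
  {
    assume "AE x in circle_lebesgue. F x = G x"
    then show "mult_op n F = mult_op n G"
      unfolding iff by (auto elim: eventually_mono)
  }
  assume "mult_op n F = mult_op n G"
  \<comment> \<open>Constant vector fields are square-integrable because the measure is finite.
    Applied to basis vectors, the two operators reveal the columns of \<open>F\<close> and
    \<open>G\<close>.\<close>
  moreover have "(\<lambda>x. unit_vec n j) \<in> L2_fun n" for j
    by (simp add: L2_fun_iff square_integrable_const)
  ultimately have "AE x in circle_lebesgue. F x *\<^sub>v unit_vec n j = G x *\<^sub>v unit_vec n j" for j
    unfolding iff by fast
  then have "AE x in circle_lebesgue. \<forall>j. F x *\<^sub>v unit_vec n j = G x *\<^sub>v unit_vec n j"
    by (simp add: AE_all_countable)
  then show "AE x in circle_lebesgue. F x = G x"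
  proof eventually_elim
    case (elim x)
    have "A $$ (i, j) = vec_index (A *\<^sub>v unit_vec n j) i"
      if "A \<in> carrier_mat n n" "i < n" "j < n" for A :: "complex Matrix.mat" and i j
      using that by (simp add: scalar_prod_right_unit[of _ n])
    then have "F x $$ (i, j) = G x $$ (i, j)" if "i < n" "j < n" for i j
      using elim carrier that by metis
    then show ?case
      using carrier[of x] by (intro eq_matI) auto
  qed
qed

lemma op_mult_mult_op:
  assumes F: "F \<in> Linf_fun n" and G: "G \<in> Linf_fun n"
  shows "op_mult n (mult_op n F) (mult_op n G) = mult_op n (\<lambda>x. F x * G x)"
proof -
  have "op_mult n (mult_op n F) (mult_op n G) = induced_op n (\<lambda>\<xi> x. F x *\<^sub>v (G x *\<^sub>v \<xi> x))"
    unfolding mult_op_def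
    by (rule op_mult_induced_op[OF respects_ae_mult[OF F] respects_ae_mult[OF G]])
  also have "\<dots> = mult_op n (\<lambda>x. F x * G x)"
    unfolding mult_op_def
  proof (subst induced_op_eq_iff)
    show "respects_ae n (\<lambda>\<xi> x. F x *\<^sub>v (G x *\<^sub>v \<xi> x))"
      using respects_ae_mult[OF F] respects_ae_mult[OF G] by (simp add: respects_ae_def)
    show "respects_ae n (\<lambda>\<xi> x. (F x * G x) *\<^sub>v \<xi> x)"
      by (rule respects_ae_mult[OF Linf_fun_mult[OF F G]])
    have "F x *\<^sub>v (G x *\<^sub>v \<xi> x) = (F x * G x) *\<^sub>v \<xi> x" if "\<xi> \<in> L2_fun n" for \<xi> x
      using F G that by (intro assoc_mult_mat_vec[of _ n n _ n, symmetric]) (auto simp: Linf_fun_iff L2_fun_iff)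
    then show "\<forall>\<xi>\<in>L2_fun n. AE x in circle_lebesgue. F x *\<^sub>v (G x *\<^sub>v \<xi> x) = (F x * G x) *\<^sub>v \<xi> x"
      by simp
  qed
  finally show ?thesis .
qed

lemma op_adjoint_mult_op:
  assumes F: "F \<in> Linf_fun n"
  shows "op_adjoint n (mult_op n F) = mult_op n (\<lambda>x. mat_adjoint (F x))"
  unfolding mult_op_def
proof (rule op_adjoint_induced_op)
  fix \<xi> \<eta> assume "\<xi> \<in> L2_fun n" "\<eta> \<in> L2_fun n"
  then have "(F x *\<^sub>v \<xi> x) \<bullet>c \<eta> x = \<xi> x \<bullet>c (mat_adjoint (F x) *\<^sub>v \<eta> x)" for x
    using F by (intro cscalar_prod_mat_adjoint[of _ n]) (auto simp: Linf_fun_iff L2_fun_iff)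
  then show "(\<integral>x. (F x *\<^sub>v \<xi> x) \<bullet>c \<eta> x \<partial>circle_lebesgue) =
      (\<integral>x. \<xi> x \<bullet>c (mat_adjoint (F x) *\<^sub>v \<eta> x) \<partial>circle_lebesgue)"
    by simp
qed (intro respects_ae_mult F Linf_fun_adjoint)+

text \<open>Makes unitarity of a multiplication operator an equation between multiplication
  operators, hence a condition on matrices almost everywhere.\<close>

lemma op_id_eq_mult_op: "op_id n = mult_op n (\<lambda>x. 1\<^sub>m n)"
proof (rule L2_op_eqI)
  fix \<xi> assume \<xi>: "\<xi> \<in> L2_fun n"
  have "mult_op n (\<lambda>x. 1\<^sub>m n) (L2_class n \<xi>) = L2_class n (\<lambda>x. 1\<^sub>m n *\<^sub>v \<xi> x)"
    unfolding mult_op_def by (rule induced_op_class[OF respects_ae_mult \<xi>]) (simp add: Linf_fun_const)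
  also have "(\<lambda>x. 1\<^sub>m n *\<^sub>v \<xi> x) = \<xi>"
    using \<xi> by (auto simp: L2_fun_iff)
  finally show "op_id n (L2_class n \<xi>) = mult_op n (\<lambda>x. 1\<^sub>m n) (L2_class n \<xi>)"
    using \<xi> by (simp add: op_id_def)
qed (simp_all add: op_id_def mult_op_def induced_op_extensional)

lemma op_unitary_mult_op_iff:
  assumes F: "F \<in> Linf_fun n"
  shows "op_unitary n (mult_op n F) \<longleftrightarrow>
    (AE x in circle_lebesgue. mat_adjoint (F x) * F x = 1\<^sub>m n) \<and>
    (AE x in circle_lebesgue. F x * mat_adjoint (F x) = 1\<^sub>m n)"
proof -
  have "mult_op n F \<in> L2 n \<rightarrow>\<^sub>E L2 n"
    unfolding mult_op_def by (rule induced_op_in[OF respects_ae_mult[OF F]])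
  then show ?thesis
    unfolding op_unitary_def op_adjoint_mult_op[OF F] op_id_eq_mult_op
    by (simp add: op_mult_mult_op mult_op_eq_iff F Linf_fun_adjoint Linf_fun_mult Linf_fun_const)
qed

text \<open>Substituting \<open>x + \<theta>\<close> for \<open>x\<close> in the inner product
  leaves the integral unchanged, so the adjoint is the opposite rotation.\<close>

lemma op_adjoint_V_op: "op_adjoint n (V_op n \<theta>) = induced_op n (\<lambda>\<xi> x. \<xi> (x + to_circle \<theta>))"
  unfolding V_op_def
proof (rule op_adjoint_induced_op)
  show "respects_ae n (\<lambda>\<xi> x. \<xi> (x - to_circle \<theta>))"
    using respects_ae_shift[of n "- to_circle \<theta>"] by simp
  fix \<xi> \<eta> assume \<xi>: "\<xi> \<in> L2_fun n" and \<eta>: "\<eta> \<in> L2_fun n"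
  have "(\<lambda>x. \<xi> (x - to_circle \<theta>)) \<in> L2_fun n"
    using respects_ae_L2_fun[OF respects_ae_shift \<xi>, of "- to_circle \<theta>"] by simp
  from integral_circle_add[OF measurable_cscalar_prod[OF this \<eta>], of "to_circle \<theta>"]
  show "(\<integral>x. \<xi> (x - to_circle \<theta>) \<bullet>c \<eta> x \<partial>circle_lebesgue) =
      (\<integral>x. \<xi> x \<bullet>c \<eta> (x + to_circle \<theta>) \<partial>circle_lebesgue)"
    by simp
qed (rule respects_ae_shift)

text \<open>The two opposite rotations cancel on the vector and leave only the argument of
  \<open>F\<close> moved.\<close>

lemma Ad_V_op_mult_op:
  assumes F: "F \<in> Linf_fun n"
  shows "Ad n (V_op n \<theta>) (mult_op n F) = mult_op n (\<lambda>x. F (x - to_circle \<theta>))"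
proof -
  have V: "respects_ae n (\<lambda>\<xi> x. \<xi> (x - to_circle \<theta>))"
    using respects_ae_shift[of n "- to_circle \<theta>"] by simp
  have "respects_ae n (\<lambda>\<xi> x. F (x - to_circle \<theta>) *\<^sub>v \<xi> (x - to_circle \<theta>))"
    using respects_ae_comp[OF V respects_ae_mult[OF F]] by simp
  then show ?thesis
    unfolding Ad_def op_adjoint_V_op
    unfolding V_op_def mult_op_def
    by (simp add: op_mult_induced_op V respects_ae_mult[OF F] respects_ae_shift)
qed

subsection \<open>Step cocycles over the rotation\<close>

text \<open>The representative in \<open>[0, 1)\<close>, a real coordinate that is discontinuous
  only at 0.\<close>

lift_definition circle_frac :: "circle \<Rightarrow> real" is frac
proof -
  fix x y :: real
  assume "int_cong x y"
  then have "x - frac y \<in> \<int>"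
    unfolding int_cong_def frac_def by (metis Ints_add Ints_of_int diff_diff_eq2 diff_add_eq)
  then show "frac x = frac y"
    by (simp add: frac_unique_iff frac_lt_1)
qed

lemma circle_frac_to_circle: "circle_frac (to_circle x) = frac x"
  by (rule circle_frac.abs_eq)

lemma measurable_circle_frac [measurable]: "circle_frac \<in> borel_measurable circle_lebesgue"
  unfolding measurable_circle_iff circle_frac_to_circle frac_def by measurable

lemma mem_arc_C_iff:
  assumes "0 < \<theta>" "\<theta> < 1"
  shows "x \<in> arc_C \<theta> \<longleftrightarrow> circle_frac x < \<theta>"
proof -
  obtain y where y: "x = to_circle y" by (rule circle_cases)
  show ?thesis
  proof
    assume "x \<in> arc_C \<theta>"
    then obtain z where z: "x = to_circle z" "0 \<le> z" "z < \<theta>"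
      by (auto simp: arc_C_def)
    then have "frac z = z"
      using assms by (simp add: frac_eq)
    then show "circle_frac x < \<theta>"
      using z by (simp add: circle_frac_to_circle)
  next
    assume "circle_frac x < \<theta>"
    then show "x \<in> arc_C \<theta>"
      unfolding arc_C_def y
      by (intro image_eqI[of _ _ "frac y"]) (auto simp: circle_frac_to_circle to_circle_frac)
  qed
qed

lemma arc_C_sets [measurable]:
  assumes "0 < \<theta>" "\<theta> < 1"
  shows "arc_C \<theta> \<in> sets circle_lebesgue"
proof -
  have "arc_C \<theta> = {x \<in> space circle_lebesgue. circle_frac x < \<theta>}"
    using mem_arc_C_iff[OF assms] by auto
  also have "\<dots> \<in> sets circle_lebesgue" by measurable
  finally show ?thesis .
qed

text \<open>Rotation by \<open>\<theta>\<close> passes the discontinuity at 0 exactly when it ends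
  in \<open>[0, \<theta>)\<close>, and the coordinate then drops by 1. This is the source of the two
  exponents \<open>\<theta> - 1\<close> and \<open>\<theta>\<close>.\<close>

lemma circle_frac_diff:
  assumes "0 < \<theta>" "\<theta> < 1"
  shows "circle_frac x = circle_frac (x - to_circle \<theta>) + (if x \<in> arc_C \<theta> then \<theta> - 1 else \<theta>)"
proof -
  obtain y where y: "x = to_circle y" by (rule circle_cases)
  \<comment> \<open>The two candidates for the fractional part of \<open>y - \<theta>\<close>; which
    one lies in \<open>[0, 1)\<close> depends on whether \<open>frac y < \<theta>\<close>.\<close>
  have fl: "y - \<theta> - (frac y - \<theta>) \<in> \<int>" "y - \<theta> - (frac y - \<theta> + 1) \<in> \<int>"
    by (simp_all add: frac_def Ints_diff)
  have "frac (y - \<theta>) = (if frac y < \<theta> then frac y - \<theta> + 1 else frac y - \<theta>)"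
    using assms fl frac_lt_1[of y] frac_ge_0[of y]
    unfolding frac_unique_iff by (auto simp del: frac_ge_0)
  then show ?thesis
    by (simp add: mem_arc_C_iff[OF assms]) (simp add: y to_circle_diff[symmetric] circle_frac_to_circle)
qed

text \<open>For each real \<open>s\<close> this exhibits a function whose rotation multiplies it by
  a factor constant on each arc. It serves to remove such a factor in one direction of the theorem
  and to create it in the other.\<close>

lemma cis_circle_frac:
  assumes "0 < \<theta>" "\<theta> < 1"
  shows "cis (s * circle_frac x) =
    cis (s * (if x \<in> arc_C \<theta> then \<theta> - 1 else \<theta>)) * cis (s * circle_frac (x - to_circle \<theta>))"
  by (subst circle_frac_diff[OF assms]) (simp add: cis_mult distrib_left add.commute)

text \<open>Multiplying \<open>f\<close> by a function from \<open>cis_circle_frac\<close> makes the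
  factor the same on both arcs. The result is an eigenfunction of the rotation, so the constant
  factor is an integer power of \<open>circle_char\<close> at \<open>\<theta>\<close>.\<close>

lemma step_cocycle_coboundary:
  assumes \<theta>: "0 < \<theta>" "\<theta> < 1"
    and c: "cmod c\<^sub>1 = 1" "cmod c\<^sub>2 = 1"
    and int: "integrable circle_lebesgue f"
    and nonzero: "AE x in circle_lebesgue. f x \<noteq> 0"
    and eq: "AE x in circle_lebesgue. f x = (if x \<in> arc_C \<theta> then c\<^sub>1 else c\<^sub>2) * f (x - to_circle \<theta>)"
  shows "\<exists>a::real. c\<^sub>1 = cis (2 * pi * a * (\<theta> - 1)) \<and> c\<^sub>2 = cis (2 * pi * a * \<theta>)"
proof -
  have c0: "c\<^sub>1 \<noteq> 0" "c\<^sub>2 \<noteq> 0"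
    using c by auto
  \<comment> \<open>The desired formulas force \<open>cis (2 * pi * a)\<close> to be the quotient of
    \<open>c\<^sub>2\<close> by \<open>c\<^sub>1\<close>. This determines \<open>a\<close> up to an
    integer; \<open>b\<close> is one candidate, and the integer \<open>k\<close> comes from the
    eigenvalue below.\<close>
  define b where "b = Arg (c\<^sub>2 / c\<^sub>1) / (2 * pi)"
  have "cis (2 * pi * b) = c\<^sub>2 / c\<^sub>1"
    using c c0 by (simp add: b_def cis_Arg sgn_div_norm norm_divide)
  then have c1: "c\<^sub>1 = c\<^sub>2 * cis (- (2 * pi * b))"
    using c0 by (simp add: cis_inverse[symmetric] del: cis_inverse)
  define s where "s = - (2 * pi * b)"
  define g where "g x = f x * cis (s * circle_frac x)" for x
  have "\<exists>k::int. c\<^sub>2 * cis (s * \<theta>) = circle_char (to_circle \<theta>) powi k"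
  proof (rule rotation_eigenvalue)
    show "integrable circle_lebesgue g"
      unfolding g_def
    proof (rule integrable_mult_bounded[OF int, where B = 1])
      show "(\<lambda>x. cis (s * circle_frac x)) \<in> borel_measurable circle_lebesgue"
        by (rule measurable_compose[of "\<lambda>x. s * circle_frac x" _ borel])
          (auto intro!: borel_measurable_continuous_onI continuous_intros)
    qed simp
    show "AE x in circle_lebesgue. g x \<noteq> 0"
      using nonzero by eventually_elim (simp add: g_def)
    show "AE x in circle_lebesgue. g x = c\<^sub>2 * cis (s * \<theta>) * g (x - to_circle \<theta>)"
      using eq
    proof eventually_elim
      case (elim x)
      \<comment> \<open>On the arc, \<open>c\<^sub>1 = c\<^sub>2 * cis s\<close> and the missing
        \<open>cis (- s)\<close> comes from the exponent \<open>\<theta> - 1\<close>.\<close>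
      have "(if x \<in> arc_C \<theta> then c\<^sub>1 else c\<^sub>2) * cis (s * (if x \<in> arc_C \<theta> then \<theta> - 1 else \<theta>)) =
          c\<^sub>2 * cis (s * \<theta>)"
        by (simp add: c1 s_def cis_mult algebra_simps)
      then show ?case
        unfolding g_def by (subst elim, subst cis_circle_frac[OF \<theta>]) (simp only: mult_ac)
    qed
  qed
  then obtain k :: int where k: "c\<^sub>2 * cis (s * \<theta>) = cis (2 * pi * \<theta>) powi k"
    by (auto simp: circle_char_to_circle)
  also have "\<dots> = cis (2 * pi * of_int k * \<theta>)"
    by (simp add: cis_power_int mult_ac)
  finally have "c\<^sub>2 * cis (s * \<theta>) * cis (- (s * \<theta>)) = cis (2 * pi * of_int k * \<theta>) * cis (- (s * \<theta>))"
    by simp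
  then have c2: "c\<^sub>2 = cis (2 * pi * (b + of_int k) * \<theta>)"
    by (simp add: mult.assoc cis_mult s_def algebra_simps)
  \<comment> \<open>Replacing \<open>b\<close> by \<open>b + k\<close> does not disturb the relation
    between \<open>c\<^sub>1\<close> and \<open>c\<^sub>2\<close>.\<close>
  have "cis (2 * pi * of_int k) = 1"
    by (rule cis_multiple_2pi) simp
  then have "cis (- (2 * pi * of_int k)) = 1"
    by (metis cis_inverse inverse_1)
  then have "c\<^sub>1 = c\<^sub>2 * cis (- (2 * pi * b)) * cis (- (2 * pi * of_int k))"
    using c1 by simp
  also have "\<dots> = cis (2 * pi * (b + of_int k) * (\<theta> - 1))"
    by (simp add: c2 cis_mult algebra_simps)
  finally show ?thesis
    using c2 by blast
qed

subsection \<open>Clock and shift matrices\<close>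

lemma smult_smult_mat: "a \<cdot>\<^sub>m (b \<cdot>\<^sub>m A) = (a * b :: 'a :: semigroup_mult) \<cdot>\<^sub>m A"
  by (intro eq_matI) (auto simp: mult.assoc)

lemma one_smult_mat: "(1 :: 'a :: monoid_mult) \<cdot>\<^sub>m A = A"
  by (intro eq_matI) auto

text \<open>The matrix \<open>u\<^sup>p v\<^sup>q\<close>.\<close>

definition clock_shift :: "nat \<Rightarrow> nat \<Rightarrow> nat \<Rightarrow> complex Matrix.mat" where
  "clock_shift n p q = Matrix.mat n n (\<lambda>(i, j). if j = (i + q) mod n then omega n ^ (p * i) else 0)"

lemma clock_shift_carrier [simp]: "clock_shift n p q \<in> carrier_mat n n"
  by (simp add: clock_shift_def)

lemma u_mat_eq_clock_shift: "u_mat n = clock_shift n 1 0"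
  by (intro eq_matI) (auto simp: u_mat_def clock_shift_def)

lemma v_mat_eq_clock_shift: "v_mat n = clock_shift n 0 1"
  by (intro eq_matI) (auto simp: v_mat_def clock_shift_def)

lemma cmod_omega [simp]: "cmod (omega n) = 1"
proof -
  have "omega n = cis (2 * pi / n)"
    by (simp add: omega_def cis_conv_exp mult_ac)
  then show ?thesis by simp
qed

lemma omega_pow_mod:
  assumes "n > 0"
  shows "omega n ^ (p * (m mod n)) = omega n ^ (p * m)"
proof -
  have "omega n ^ (p * m) = omega n ^ (p * (n * (m div n) + m mod n))"
    by simp
  also have "p * (n * (m div n) + m mod n) = n * (p * (m div n)) + p * (m mod n)"
    by (simp only: distrib_left mult.left_commute)
  also have "omega n ^ \<dots> = omega n ^ (p * (m mod n))"
    by (simp add: power_add power_mult omega_pow[OF assms])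
  finally show ?thesis by simp
qed

text \<open>The Weyl commutation relation: moving the \<open>q\<close>-th power of \<open>v\<close>
  past the \<open>p'\<close>-th power of \<open>u\<close> costs the factor
  \<open>omega n ^ (p' * q)\<close>.\<close>

lemma clock_shift_mult:
  assumes "n > 0"
  shows "clock_shift n p q * clock_shift n p' q' = omega n ^ (p' * q) \<cdot>\<^sub>m clock_shift n (p + p') (q + q')"
proof (rule eq_matI)
  fix i j
  assume "i < dim_row (omega n ^ (p' * q) \<cdot>\<^sub>m clock_shift n (p + p') (q + q'))"
    "j < dim_col (omega n ^ (p' * q) \<cdot>\<^sub>m clock_shift n (p + p') (q + q'))"
  then have ij: "i < n" "j < n"
    by (simp_all add: clock_shift_def)
  have "(clock_shift n p q * clock_shift n p' q') $$ (i, j) =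
      (\<Sum>k\<in>{0..<n}. clock_shift n p q $$ (i, k) * clock_shift n p' q' $$ (k, j))"
    using ij by (intro mat_mult_index) auto
  also have "\<dots> = (\<Sum>k\<in>{0..<n}. if k = (i + q) mod n
      then omega n ^ (p * i) * clock_shift n p' q' $$ (k, j) else 0)"
    using ij by (intro sum.cong) (auto simp: clock_shift_def)
  also have "\<dots> = omega n ^ (p * i) * clock_shift n p' q' $$ ((i + q) mod n, j)"
    using assms by simp
  also have "\<dots> = omega n ^ (p * i) *
      (if j = (i + q + q') mod n then omega n ^ (p' * (i + q)) else 0)"
    using assms ij by (simp add: clock_shift_def mod_simps omega_pow_mod)
  also have "\<dots> = (omega n ^ (p' * q) \<cdot>\<^sub>m clock_shift n (p + p') (q + q')) $$ (i, j)"
    using ij by (simp add: clock_shift_def power_add[symmetric] algebra_simps)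
  finally show "(clock_shift n p q * clock_shift n p' q') $$ (i, j) =
      (omega n ^ (p' * q) \<cdot>\<^sub>m clock_shift n (p + p') (q + q')) $$ (i, j)" .
qed (simp_all add: clock_shift_def)

text \<open>Each row has a single nonzero entry, of modulus 1, and different rows have it in
  different columns. The second identity follows since one-sided inverses of square matrices are
  two-sided.\<close>

lemma clock_shift_unitary:
  assumes "n > 0"
  shows "clock_shift n p q * mat_adjoint (clock_shift n p q) = 1\<^sub>m n"
    and "mat_adjoint (clock_shift n p q) * clock_shift n p q = 1\<^sub>m n"
proof -
  let ?Z = "clock_shift n p q"
  have Z: "?Z \<in> carrier_mat n n" "mat_adjoint ?Z \<in> carrier_mat n n"
    by (simp_all add: mat_adjoint_carrier)
  show right: "?Z * mat_adjoint ?Z = 1\<^sub>m n"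
  proof (rule eq_matI)
    fix i j
    assume "i < dim_row (1\<^sub>m n :: complex Matrix.mat)" "j < dim_col (1\<^sub>m n :: complex Matrix.mat)"
    then have ij: "i < n" "j < n" by auto
    have adj: "mat_adjoint ?Z $$ (k, j) = cnj (?Z $$ (j, k))" if "k < n" for k
      using that ij by (simp add: mat_adjoint_index[OF Z(1)])
    have entry: "?Z $$ (i, k) = (if k = (i + q) mod n then omega n ^ (p * i) else 0)" if "k < n" for k
      using that ij by (simp add: clock_shift_def)
    have "(?Z * mat_adjoint ?Z) $$ (i, j) = (\<Sum>k\<in>{0..<n}. ?Z $$ (i, k) * mat_adjoint ?Z $$ (k, j))"
      using ij Z by (intro mat_mult_index)
    also have "\<dots> = (\<Sum>k\<in>{0..<n}. if k = (i + q) mod n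
        then omega n ^ (p * i) * cnj (?Z $$ (j, k)) else 0)"
      by (intro sum.cong) (auto simp: adj entry)
    also have "\<dots> = omega n ^ (p * i) * cnj (?Z $$ (j, (i + q) mod n))"
      using assms by simp
    also have "(i + q) mod n = (j + q) mod n \<longleftrightarrow> i = j"
      using ij cong_add_rcancel_nat[of i q j n] by (simp add: cong_def)
    then have "omega n ^ (p * i) * cnj (?Z $$ (j, (i + q) mod n)) = (if i = j then 1 else 0)"
      using assms ij by (auto simp: clock_shift_def complex_norm_square[symmetric] norm_power
          simp flip: complex_cnj_power)
    finally show "(?Z * mat_adjoint ?Z) $$ (i, j) = 1\<^sub>m n $$ (i, j)"
      using ij by simp
  qed (simp_all add: carrier_matD[OF Z(1)] carrier_matD[OF Z(2)])
  show "mat_adjoint ?Z * ?Z = 1\<^sub>m n"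
    by (rule mat_mult_left_right_inverse[OF Z right])
qed

text \<open>Multiplying the relation by the adjoint of \<open>A\<close> on both sides moves
  \<open>c\<close> across without conjugating it. It transfers commutation with \<open>u\<close> and
  \<open>v\<close> to the adjoints that occur in \<open>W_op\<close>.\<close>

lemma mat_adjoint_commute:
  fixes A Z :: "complex Matrix.mat"
  assumes A: "A \<in> carrier_mat n n" and Z: "Z \<in> carrier_mat n n"
    and unitary: "A * mat_adjoint A = 1\<^sub>m n" "mat_adjoint A * A = 1\<^sub>m n"
    and comm: "A * Z = c \<cdot>\<^sub>m (Z * A)"
  shows "Z * mat_adjoint A = c \<cdot>\<^sub>m (mat_adjoint A * Z)"
proof -
  note B = mat_adjoint_carrier[OF A]
  have "Z * mat_adjoint A = (mat_adjoint A * A) * Z * mat_adjoint A"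
    using Z by (simp add: unitary)
  also have "\<dots> = mat_adjoint A * (A * Z) * mat_adjoint A"
    using assoc_mult_mat[OF B A Z] by simp
  also have "\<dots> = c \<cdot>\<^sub>m (mat_adjoint A * (Z * A) * mat_adjoint A)"
    unfolding comm
    by (simp only: mult_smult_distrib[OF B mult_carrier_mat[OF Z A]]
        mult_smult_assoc_mat[OF mult_carrier_mat[OF B mult_carrier_mat[OF Z A]] B])
  also have "mat_adjoint A * (Z * A) * mat_adjoint A = mat_adjoint A * Z * (A * mat_adjoint A)"
    using A B Z by (simp add: assoc_mult_mat[of _ n n _ n _ n])
  also have "\<dots> = mat_adjoint A * Z"
    using B Z by (simp add: unitary)
  finally show ?thesis .
qed

text \<open>The phase against the adjoint of \<open>u\<close> depends on \<open>q\<close> alone,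
  while that against the adjoint of \<open>v\<close> depends on \<open>p\<close> alone. The phases
  on the two arcs can therefore be adjusted independently.\<close>

lemma clock_shift_mult_u_adjoint:
  assumes "n > 0"
  shows "clock_shift n p q * mat_adjoint (u_mat n) =
    cnj (omega n ^ q) \<cdot>\<^sub>m (mat_adjoint (u_mat n) * clock_shift n p q)"
proof -
  have "cnj (omega n ^ q) * omega n ^ q = 1"
    by (simp add: mult.commute[of "cnj _"] complex_norm_square[symmetric] norm_power
        del: complex_cnj_power)
  then show ?thesis
    unfolding u_mat_eq_clock_shift
    using assms by (intro mat_adjoint_commute[of _ n])
      (simp_all add: clock_shift_unitary clock_shift_mult smult_smult_mat one_smult_mat add.commute)
qed

lemma clock_shift_mult_v_adjoint:
  assumes "n > 0"
  shows "clock_shift n p q * mat_adjoint (v_mat n) =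
    omega n ^ p \<cdot>\<^sub>m (mat_adjoint (v_mat n) * clock_shift n p q)"
  unfolding v_mat_eq_clock_shift using assms
  by (intro mat_adjoint_commute[of _ n])
    (simp_all add: clock_shift_unitary clock_shift_mult one_smult_mat add.commute)

lemma root_of_unity_omega:
  assumes "n > 0" "z ^ n = 1"
  obtains p where "z = omega n ^ p"
proof -
  obtain p where "z = cis (2 * pi * real p / real n)"
    using Complex.bij_betw_roots_unity[OF assms(1)] assms(2) unfolding bij_betw_def by blast
  also have "\<dots> = omega n ^ p"
    by (simp add: omega_def cis_conv_exp exp_of_nat_mult[symmetric] mult_ac)
  finally show ?thesis by (rule that)
qed

subsection \<open>Unitary equivalence\<close>

text \<open>The pointwise form of the function in \<open>W_op\<close>: the arcs are complementary,
  so only one of the two tensors survives at each point.\<close>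

definition W_fun :: "nat \<Rightarrow> real \<Rightarrow> complex \<times> complex \<Rightarrow> circle \<Rightarrow> complex Matrix.mat" where
  "W_fun n \<theta> l x = (if x \<in> arc_C \<theta> then fst l \<cdot>\<^sub>m mat_adjoint (u_mat n)
     else snd l \<cdot>\<^sub>m mat_adjoint (v_mat n))"

lemma u_v_adjoint_carrier [simp]:
  "mat_adjoint (u_mat n) \<in> carrier_mat n n" "mat_adjoint (v_mat n) \<in> carrier_mat n n"
  by (simp_all add: u_mat_eq_clock_shift v_mat_eq_clock_shift mat_adjoint_carrier)

lemma W_fun_carrier [simp]: "W_fun n \<theta> l x \<in> carrier_mat n n"
  by (simp add: W_fun_def)

lemma W_op_eq_mult_op: "W_op n \<theta> l = mult_op n (W_fun n \<theta> l)"
proof -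
  have "1 \<cdot>\<^sub>m A + 0 \<cdot>\<^sub>m B = A" "0 \<cdot>\<^sub>m B + 1 \<cdot>\<^sub>m A = A"
    if "A \<in> carrier_mat n n" "B \<in> carrier_mat n n" for A B :: "complex Matrix.mat"
    using that by (auto intro!: eq_matI)
  then show ?thesis
    unfolding W_op_def by (intro arg_cong[of _ _ "mult_op n"])
      (auto simp: W_fun_def tensor_def arc_D_def indicator_def)
qed

lemma W_fun_in_Linf:
  assumes "0 < \<theta>" "\<theta> < 1"
  shows "W_fun n \<theta> l \<in> Linf_fun n"
  unfolding Linf_fun_iff
proof (intro conjI allI impI)
  fix i j assume ij: "i < n" "j < n"
  have [measurable]: "arc_C \<theta> \<in> sets circle_lebesgue"
    using assms by (rule arc_C_sets)
  let ?a = "(fst l \<cdot>\<^sub>m mat_adjoint (u_mat n)) $$ (i, j)"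
  let ?b = "(snd l \<cdot>\<^sub>m mat_adjoint (v_mat n)) $$ (i, j)"
  have "(\<lambda>x. W_fun n \<theta> l x $$ (i, j)) = (\<lambda>x. if x \<in> arc_C \<theta> then ?a else ?b)"
    by (auto simp: W_fun_def)
  moreover have "ess_bounded circle_lebesgue (\<lambda>x. if x \<in> arc_C \<theta> then ?a else ?b)"
    unfolding ess_bounded_def
  proof
    show "(\<lambda>x. if x \<in> arc_C \<theta> then ?a else ?b) \<in> borel_measurable circle_lebesgue"
      by measurable
    show "\<exists>B. AE x in circle_lebesgue. cmod (if x \<in> arc_C \<theta> then ?a else ?b) \<le> B"
      by (intro exI[of _ "max (cmod ?a) (cmod ?b)"] AE_I2) simp
  qed
  ultimately show "ess_bounded circle_lebesgue (\<lambda>x. W_fun n \<theta> l x $$ (i, j))" by simp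
qed simp

text \<open>Every operator in the equation is a multiplication operator once \<open>Ad\<close> has
  been evaluated, so composition and adjoint become pointwise operations on matrices.\<close>

lemma W_op_equation_iff:
  assumes \<theta>: "0 < \<theta>" "\<theta> < 1" and F: "F \<in> Linf_fun n"
  shows "W_op n \<theta> l =
      op_mult n (op_mult n (mult_op n F) (W_op n \<theta> l')) (op_adjoint n (Ad n (V_op n \<theta>) (mult_op n F)))
    \<longleftrightarrow> (AE x in circle_lebesgue.
      W_fun n \<theta> l x = F x * W_fun n \<theta> l' x * mat_adjoint (F (x - to_circle \<theta>)))"
  unfolding W_op_eq_mult_op
  by (simp add: Ad_V_op_mult_op op_adjoint_mult_op op_mult_mult_op mult_op_eq_iff F
      Linf_fun_mult Linf_fun_shift Linf_fun_adjoint W_fun_in_Linf[OF \<theta>])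

section \<open>Determinants\<close>

lemma ess_bounded_prod:
  assumes "\<And>i. i \<in> I \<Longrightarrow> ess_bounded M (f i)"
  shows "ess_bounded M (\<lambda>x. \<Prod>i\<in>I. f i x)"
  using assms
proof (induction I rule: infinite_finite_induct)
  case (insert i I)
  then show ?case by (simp add: ess_bounded_mult)
qed (simp_all add: ess_bounded_const)

text \<open>By the Leibniz formula the determinant is a polynomial in the entries.\<close>

lemma ess_bounded_det:
  assumes F: "F \<in> Linf_fun n"
  shows "ess_bounded circle_lebesgue (\<lambda>x. Determinant.det (F x))"
proof -
  have "ess_bounded circle_lebesgue
      (\<lambda>x. \<Sum>p | p permutes {0..<n}. signof p * (\<Prod>i = 0..<n. F x $$ (i, p i)))"
    using F by (intro ess_bounded_sum ess_bounded_mult ess_bounded_prod ess_bounded_const)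
      (auto simp: Linf_fun_iff permutes_in_image)
  then show ?thesis
    using F by (subst det_def'[of _ n]) (auto simp: Linf_fun_iff)
qed

lemma ess_bounded_integrable: "ess_bounded circle_lebesgue f \<Longrightarrow> integrable circle_lebesgue f"
  unfolding ess_bounded_def by (auto intro: circle_lebesgue.integrable_const_bound)

text \<open>Scalars leave the determinant as \<open>n\<close>-th powers; this is how the powers in
  the second condition arise.\<close>

lemma det_W_fun:
  "Determinant.det (W_fun n \<theta> l x) = (if x \<in> arc_C \<theta> then fst l ^ n * Determinant.det (mat_adjoint (u_mat n))
     else snd l ^ n * Determinant.det (mat_adjoint (v_mat n)))"
  using u_v_adjoint_carrier[THEN carrier_matD(2), of n] by (simp add: W_fun_def)

lemma det_nonzero_of_inverse:
  assumes "A \<in> carrier_mat n n" "B \<in> carrier_mat n n" "A * B = 1\<^sub>m n"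
  shows "Determinant.det A \<noteq> (0 :: complex)"
  using det_mult[OF assms(1,2)] assms(3) by auto

theorem proposition4p14:
  fixes \<theta> :: real and n :: nat and l l' :: "complex \<times> complex"
  assumes "0 < \<theta>" and "\<theta> < 1 / 2" and "\<theta> \<notin> \<rat>"
    and "n > 1"
    and "cmod (fst l) = 1" and "cmod (snd l) = 1"
    and "cmod (fst l') = 1" and "cmod (snd l') = 1"
  shows "(\<exists>\<zeta>\<in>Linf_Mn n. op_unitary n \<zeta> \<and>
            W_op n \<theta> l =
              op_mult n (op_mult n \<zeta> (W_op n \<theta> l')) (op_adjoint n (Ad n (V_op n \<theta>) \<zeta>)))
         \<longleftrightarrow>
         (\<exists>a::real.
            fst l ^ n = exp (2 * of_real pi * \<i> * of_real a * of_real (\<theta> - 1)) * fst l' ^ n \<and>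
            snd l ^ n = exp (2 * of_real pi * \<i> * of_real a * of_real \<theta>) * snd l' ^ n)"
proof
  have \<theta>: "0 < \<theta>" "\<theta> < 1" and n: "n > 0"
    using assms by auto
  have l0: "fst l \<noteq> 0" "snd l \<noteq> 0" "fst l' \<noteq> 0" "snd l' \<noteq> 0"
    using assms by auto
  have exp_cis: "exp (2 * of_real pi * \<i> * of_real a * of_real b) = cis (2 * pi * a * b)" for a b
    by (simp add: cis_conv_exp mult_ac)
  {
    \<comment> \<open>From the unitary to the number \<open>a\<close>: the determinant of a
      representing function is fed into \<open>step_cocycle_coboundary\<close>.\<close>
    assume "\<exists>\<zeta>\<in>Linf_Mn n. op_unitary n \<zeta> \<and> W_op n \<theta> l =
      op_mult n (op_mult n \<zeta> (W_op n \<theta> l')) (op_adjoint n (Ad n (V_op n \<theta>) \<zeta>))"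
    then obtain F where F: "F \<in> Linf_fun n" and unitary: "op_unitary n (mult_op n F)"
      and eq: "W_op n \<theta> l = op_mult n (op_mult n (mult_op n F) (W_op n \<theta> l'))
        (op_adjoint n (Ad n (V_op n \<theta>) (mult_op n F)))"
      unfolding Linf_Mn_def by blast
    have carrier: "F x \<in> carrier_mat n n" "mat_adjoint (F x) \<in> carrier_mat n n" for x
      using F by (simp_all add: Linf_fun_iff mat_adjoint_carrier)
    have inv: "AE x in circle_lebesgue. mat_adjoint (F x) * F x = 1\<^sub>m n"
      "AE x in circle_lebesgue. F x * mat_adjoint (F x) = 1\<^sub>m n"
      using unitary by (simp_all add: op_unitary_mult_op_iff[OF F])
    define f where "f x = Determinant.det (F x)" for x
    have "\<exists>a. (fst l / fst l') ^ n = cis (2 * pi * a * (\<theta> - 1)) \<and>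
        (snd l / snd l') ^ n = cis (2 * pi * a * \<theta>)"
    proof (rule step_cocycle_coboundary[OF \<theta>])
      show "integrable circle_lebesgue f"
        unfolding f_def by (rule ess_bounded_integrable[OF ess_bounded_det[OF F]])
      show "AE x in circle_lebesgue. f x \<noteq> 0"
        using inv(2) unfolding f_def
        by eventually_elim (rule det_nonzero_of_inverse[OF carrier])
      have W: "AE x in circle_lebesgue.
          W_fun n \<theta> l x = F x * W_fun n \<theta> l' x * mat_adjoint (F (x - to_circle \<theta>))"
        using eq W_op_equation_iff[OF \<theta> F] by blast
      have "AE x in circle_lebesgue.
          mat_adjoint (F (x - to_circle \<theta>)) * F (x - to_circle \<theta>) = 1\<^sub>m n"
        using AE_circle_add[OF inv(1), of "- to_circle \<theta>"] by simp
      with W show "AE x in circle_lebesgue. f x =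
          (if x \<in> arc_C \<theta> then (fst l / fst l') ^ n else (snd l / snd l') ^ n) * f (x - to_circle \<theta>)"
      proof eventually_elim
        case (elim x)
        let ?y = "x - to_circle \<theta>"
        \<comment> \<open>Cancelling the adjoint by unitarity first avoids the determinant of an
          adjoint.\<close>
        have "W_fun n \<theta> l x * F ?y = F x * W_fun n \<theta> l' x * (mat_adjoint (F ?y) * F ?y)"
          unfolding elim(1)
          by (intro assoc_mult_mat[of _ n n _ n _ n] mult_carrier_mat[of _ n n] carrier W_fun_carrier)
        also have "\<dots> = F x * W_fun n \<theta> l' x"
          unfolding elim(2)
          by (intro right_mult_one_mat[of _ n] mult_carrier_mat[of _ n n] carrier W_fun_carrier)
        finally have "Determinant.det (W_fun n \<theta> l x) * f ?y = f x * Determinant.det (W_fun n \<theta> l' x)"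
          unfolding f_def using det_mult[of _ n] carrier W_fun_carrier by metis
        \<comment> \<open>These determinants occur on both sides and cancel, leaving only the
          quotients of the scalars.\<close>
        moreover have "Determinant.det (mat_adjoint (u_mat n)) \<noteq> 0"
          "Determinant.det (mat_adjoint (v_mat n)) \<noteq> 0"
          unfolding u_mat_eq_clock_shift v_mat_eq_clock_shift
          by (rule det_nonzero_of_inverse[OF mat_adjoint_carrier _ clock_shift_unitary(2)[OF n]]; simp)+
        ultimately show ?case
          using l0 by (auto simp: det_W_fun field_simps split: if_splits)
      qed
    qed (simp_all add: norm_power norm_divide assms)
    then show "\<exists>a::real.
        fst l ^ n = exp (2 * of_real pi * \<i> * of_real a * of_real (\<theta> - 1)) * fst l' ^ n \<and>
        snd l ^ n = exp (2 * of_real pi * \<i> * of_real a * of_real \<theta>) * snd l' ^ n"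
      unfolding exp_cis using l0 by (simp add: power_divide divide_eq_eq)
  }
  \<comment> \<open>From \<open>a\<close> to a unitary: the witness is a scalar function times a
    fixed \<open>clock_shift\<close> matrix.\<close>
  assume "\<exists>a::real.
      fst l ^ n = exp (2 * of_real pi * \<i> * of_real a * of_real (\<theta> - 1)) * fst l' ^ n \<and>
      snd l ^ n = exp (2 * of_real pi * \<i> * of_real a * of_real \<theta>) * snd l' ^ n"
  then obtain a where a: "fst l ^ n = cis (2 * pi * a * (\<theta> - 1)) * fst l' ^ n"
      "snd l ^ n = cis (2 * pi * a * \<theta>) * snd l' ^ n"
    unfolding exp_cis by blast
  \<comment> \<open>The division by \<open>n\<close> is needed because \<open>a\<close> is tied to
    \<open>n\<close>-th powers, while the scalar factor acts on the numbers themselves.\<close>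
  define s where "s = 2 * pi * a / n"
  have cis_n: "cis (s * b) ^ n = cis (2 * pi * a * b)" for b
    using n by (simp add: Complex.DeMoivre s_def)
  \<comment> \<open>\<open>\<mu>\<^sub>1\<close> and \<open>\<mu>\<^sub>2\<close> are what the
    scalar factor makes of the entries of \<open>l'\<close>; they have the same \<open>n\<close>-th
    powers as the entries of \<open>l\<close>.\<close>
  define \<mu>\<^sub>1 where "\<mu>\<^sub>1 = cis (s * (\<theta> - 1)) * fst l'"
  define \<mu>\<^sub>2 where "\<mu>\<^sub>2 = cis (s * \<theta>) * snd l'"
  have \<mu>0: "\<mu>\<^sub>1 \<noteq> 0" "\<mu>\<^sub>2 \<noteq> 0"
    using l0 by (simp_all add: \<mu>\<^sub>1_def \<mu>\<^sub>2_def)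
  \<comment> \<open>The quotients are oriented oppositely because conjugation by the matrix
    contributes \<open>cnj (omega n ^ q)\<close> on \<open>arc_C\<close> but
    \<open>omega n ^ p\<close> on \<open>arc_D\<close>.\<close>
  have "(\<mu>\<^sub>1 / fst l) ^ n = 1" "(snd l / \<mu>\<^sub>2) ^ n = 1"
    using a l0 by (simp_all add: \<mu>\<^sub>1_def \<mu>\<^sub>2_def power_divide power_mult_distrib cis_n)
  then obtain p q where q: "\<mu>\<^sub>1 / fst l = omega n ^ q" and p: "snd l / \<mu>\<^sub>2 = omega n ^ p"
    using root_of_unity_omega[OF n] by metis
  have "cnj (omega n ^ q) * omega n ^ q = 1"
    by (simp add: mult.commute[of "cnj _"] complex_norm_square[symmetric] norm_power
        del: complex_cnj_power)
  then have l1: "\<mu>\<^sub>1 * cnj (omega n ^ q) = fst l"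
    using q l0 by (simp add: divide_eq_eq mult_ac del: complex_cnj_power)
  have l2: "\<mu>\<^sub>2 * omega n ^ p = snd l"
    using p \<mu>0 by (simp add: divide_eq_eq mult_ac)
  define h where "h x = cis (s * circle_frac x)" for x
  define Z where "Z = clock_shift n p q"
  define F where "F x = h x \<cdot>\<^sub>m Z" for x
  have Z: "Z \<in> carrier_mat n n" "mat_adjoint Z \<in> carrier_mat n n"
    by (simp_all add: Z_def mat_adjoint_carrier)
  have Zu: "Z * mat_adjoint Z = 1\<^sub>m n" "mat_adjoint Z * Z = 1\<^sub>m n"
    unfolding Z_def by (rule clock_shift_unitary[OF n])+
  have h1: "h x * cnj (h x) = 1" for x
    by (simp add: h_def complex_norm_square[symmetric] del: cis_cnj)
  have F_adj: "mat_adjoint (F x) = cnj (h x) \<cdot>\<^sub>m mat_adjoint Z" for x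
    using Z mat_adjoint_carrier[of "F x" n]
    by (intro eq_matI) (auto simp: F_def mat_adjoint_index[of _ n])
  have F: "F \<in> Linf_fun n"
  proof -
    have "h \<in> borel_measurable circle_lebesgue"
      unfolding h_def by (rule measurable_compose[of "\<lambda>x. s * circle_frac x" _ borel])
        (auto intro!: borel_measurable_continuous_onI continuous_intros)
    then have "ess_bounded circle_lebesgue h"
      by (auto simp: ess_bounded_def h_def intro!: exI[of _ 1])
    then show ?thesis
      using Z by (auto simp: Linf_fun_iff F_def intro!: ess_bounded_mult ess_bounded_const)
  qed
  have "op_unitary n (mult_op n F)"
    unfolding op_unitary_mult_op_iff[OF F] F_adj unfolding F_def
    using Z h1 by (simp add: mult_smult_distrib[of _ n n _ n] mult_smult_assoc_mat[of _ n n _ n]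
        smult_smult_mat one_smult_mat Zu mult.commute[of "cnj _"])
  moreover have "W_fun n \<theta> l x = F x * W_fun n \<theta> l' x * mat_adjoint (F (x - to_circle \<theta>))" for x
  proof -
    let ?y = "x - to_circle \<theta>"
    \<comment> \<open>On each arc the function is a scalar multiple of a matrix \<open>A\<close>
      that commutes with \<open>Z\<close> up to a factor \<open>d\<close>. Conjugation thus
      contributes \<open>d\<close> from \<open>Z\<close> and a quotient of values of
      \<open>h\<close> from the scalar part.\<close>
    have key: "F x * (c \<cdot>\<^sub>m A) * mat_adjoint (F ?y) = (h x * c * d * cnj (h ?y)) \<cdot>\<^sub>m A"
      if A: "A \<in> carrier_mat n n" and comm: "Z * A = d \<cdot>\<^sub>m (A * Z)" for A c d
    proof -
      have "F x * (c \<cdot>\<^sub>m A) * mat_adjoint (F ?y) = (h x * c * cnj (h ?y)) \<cdot>\<^sub>m (Z * A * mat_adjoint Z)"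
        unfolding F_adj unfolding F_def using Z A
        by (simp add: mult_smult_distrib[of _ n n _ n] mult_smult_assoc_mat[of _ n n _ n]
            smult_smult_mat one_smult_mat mult_ac)
      also have "Z * A * mat_adjoint Z = d \<cdot>\<^sub>m (A * (Z * mat_adjoint Z))"
        unfolding comm using Z A by (simp add: mult_smult_assoc_mat[of _ n n _ n] assoc_mult_mat[of _ n n _ n _ n])
      also have "\<dots> = d \<cdot>\<^sub>m A"
        using A by (simp add: Zu)
      finally show ?thesis
        by (simp add: smult_smult_mat one_smult_mat mult_ac)
    qed
    \<comment> \<open>Since \<open>h\<close> has modulus 1, its conjugate at \<open>?y\<close> is
      the inverse, and the coboundary identity gives the factor.\<close>
    have h: "h x * cnj (h ?y) = cis (s * (if x \<in> arc_C \<theta> then \<theta> - 1 else \<theta>))"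
      using h1[of ?y] unfolding h_def by (subst cis_circle_frac[OF \<theta>]) (simp only: mult.assoc mult_1_right)
    show ?thesis
    proof (cases "x \<in> arc_C \<theta>")
      case True
      have "h x * fst l' * cnj (omega n ^ q) * cnj (h ?y) =
          (h x * cnj (h ?y)) * (fst l' * cnj (omega n ^ q))"
        by (simp only: mult_ac)
      also have "\<dots> = fst l"
        unfolding h using True l1 by (simp add: \<mu>\<^sub>1_def mult.assoc)
      finally show ?thesis
        using key[OF u_v_adjoint_carrier(1) clock_shift_mult_u_adjoint[OF n, of p q, folded Z_def], of "fst l'"] True
        by (simp add: W_fun_def)
    next
      case False
      have "h x * snd l' * omega n ^ p * cnj (h ?y) =
          (h x * cnj (h ?y)) * (snd l' * omega n ^ p)"
        by (simp only: mult_ac)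
      also have "\<dots> = snd l"
        unfolding h using False l2 by (simp add: \<mu>\<^sub>2_def mult.assoc)
      finally show ?thesis
        using key[OF u_v_adjoint_carrier(2) clock_shift_mult_v_adjoint[OF n, of p q, folded Z_def], of "snd l'"] False
        by (simp add: W_fun_def)
    qed
  qed
  then have "W_op n \<theta> l = op_mult n (op_mult n (mult_op n F) (W_op n \<theta> l'))
      (op_adjoint n (Ad n (V_op n \<theta>) (mult_op n F)))"
    unfolding W_op_equation_iff[OF \<theta> F] by simp
  ultimately show "\<exists>\<zeta>\<in>Linf_Mn n. op_unitary n \<zeta> \<and> W_op n \<theta> l =
      op_mult n (op_mult n \<zeta> (W_op n \<theta> l')) (op_adjoint n (Ad n (V_op n \<theta>) \<zeta>))"
    using F unfolding Linf_Mn_def by blast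
qed

end
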